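(* For every associative conformal algebra $C$ over $\mathbb{C}$ with coefficient algebra $\operatorname{Coeff}C$, one has $$\operatorname{GKdim}\operatorname{Coeff}C\le \operatorname{GKdim}C+1 .$$
   Context: Everything is over $\mathbb{C}$. Conformal algebra: a $\mathbb{C}[\partial]$-module $C$ with $\mathbb{C}$-bilinear products $\circ_n$, $n\in\mathbb{Z}_{\ge 0}$, such that for all $a,b\in C$: (C1, locality) $a\circ_n b=0$ for all sufficiently large $n$; (C2) $\partial(a\circ_n b)=(\partial a)\circ_n b+a\circ_n(\partial b)$; (C3) $(\partial a)\circ_n b=-n\,a\circ_{n-1}b$ (so $(\partial a)\circ_0 b=0$). Coefficient algebra: on $\tilde C=C[t,t^{-1}]$ put $(at^l)\circ_0(bt^m)=\sum_{j\ge 0}\binom{l}{j}(a\circ_j b)\,t^{l+m-j}$. Then $\operatorname{Coeff}C=(\tilde C,\circ_0)/(\partial+\frac{d}{dt})\tilde C$. $C$ is called associative if $\operatorname{Coeff}C$ is an associative algebra; equivalently, $f\circ_m(g\circ_n h)=\sum_{j\ge 0}\binom{m}{j}(f\circ_j g)\circ_{m+n-j}h$ for all $f,g,h\in C$ and $m,n\ge 0$. Gelfand–Kirillov dimension of a conformal algebra: if $C$ is generated (under $\partial$ and all products) by $f_1,\dots,f_k$, let $C_r$ be the $\mathbb{C}[\partial]$-span of all products of at most $r$ generators (any bracketing, any orders of multiplication). Then $\operatorname{GKdim}C=\limsup_{r\to\infty}\frac{\log \operatorname{rk}_{\mathbb{C}[\partial]}C_r}{\log r}$ (taken to be $0$ when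 $C$ is a torsion $\mathbb{C}[\partial]$-module, so that all ranks are $0$); this does not depend on the choice of generators. If $C$ is not finitely generated, $\operatorname{GKdim}C$ is the supremum of $\operatorname{GKdim}C'$ over finitely generated conformal subalgebras $C'\subset C$. Gelfand–Kirillov dimension of an ordinary algebra $R$: if $R$ is generated by a finite-dimensional subspace $V$, $\operatorname{GKdim}R=\limsup_{r\to\infty}\frac{\log\dim(V^1+\dots+V^r)}{\log r}$; in general it is the supremum over finitely generated subalgebras. *)

theory Defs
  imports
    "HOL-Analysis.Analysis"
    "HOL-Computational_Algebra.Polynomial"
    "HOL-Library.Poly_Mapping"
    "HOL-Library.Groups_Big_Fun"
begin

section \<open>Conformal algebras\<close>

text \<open>
  A module over the polynomial ring \<open>\<complex>[\<partial>]\<close>: the indeterminate of \<^typ>\<open>complex poly\<close> plays the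
  role of \<open>\<partial>\<close>, and the underlying complex vector space is obtained through constant polynomials.
\<close>

class cpoly_module = ab_group_add +
  fixes pscale :: "complex poly \<Rightarrow> 'a \<Rightarrow> 'a"  (infixr \<open>\<bullet>\<^sub>p\<close> 75)
  assumes pscale_right_distrib: "p \<bullet>\<^sub>p (x + y) = p \<bullet>\<^sub>p x + p \<bullet>\<^sub>p y"
    and pscale_left_distrib: "(p + q) \<bullet>\<^sub>p x = p \<bullet>\<^sub>p x + q \<bullet>\<^sub>p x"
    and pscale_pscale: "p \<bullet>\<^sub>p (q \<bullet>\<^sub>p x) = (p * q) \<bullet>\<^sub>p x"
    and pscale_one: "1 \<bullet>\<^sub>p x = x"
begin

definition del :: "'a \<Rightarrow> 'a"  (\<open>\<partial>\<close>)
  where "\<partial> x = [:0, 1:] \<bullet>\<^sub>p x"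

definition cscale :: "complex \<Rightarrow> 'a \<Rightarrow> 'a"  (infixr \<open>\<bullet>\<^sub>c\<close> 75)
  where "c \<bullet>\<^sub>c x = [:c:] \<bullet>\<^sub>p x"

end

global_interpretation pm: module "pscale :: complex poly \<Rightarrow> 'a :: cpoly_module \<Rightarrow> 'a"
  by standard
    (simp_all add: pscale_right_distrib pscale_left_distrib pscale_pscale pscale_one)

global_interpretation pmv: vector_space "cscale :: complex \<Rightarrow> 'a :: cpoly_module \<Rightarrow> 'a"
proof
  fix a b :: complex and x y :: 'a
  show "a \<bullet>\<^sub>c (x + y) = a \<bullet>\<^sub>c x + a \<bullet>\<^sub>c y" by (simp add: cscale_def pscale_right_distrib)
  show "(a + b) \<bullet>\<^sub>c x = a \<bullet>\<^sub>c x + b \<bullet>\<^sub>c x"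
    by (simp add: cscale_def flip: pscale_left_distrib)
  show "a \<bullet>\<^sub>c (b \<bullet>\<^sub>c x) = (a * b) \<bullet>\<^sub>c x"
    by (simp add: cscale_def pscale_pscale mult.commute)
  show "1 \<bullet>\<^sub>c x = x" by (simp add: cscale_def pscale_one flip: one_pCons)
qed

lemma del_add: "\<partial> (x + y) = \<partial> x + \<partial> (y :: 'a :: cpoly_module)"
  by (simp add: del_def pscale_right_distrib)

lemma del_zero [simp]: "\<partial> (0 :: 'a :: cpoly_module) = 0"
  by (simp add: del_def)

lemma del_cscale: "\<partial> (c \<bullet>\<^sub>c x) = c \<bullet>\<^sub>c \<partial> (x :: 'a :: cpoly_module)"
  by (simp add: del_def cscale_def pscale_pscale mult.commute)

class conformal_algebra = cpoly_module +
  fixes cprod :: "'a \<Rightarrow> nat \<Rightarrow> 'a \<Rightarrow> 'a"  (\<open>(_ \<odot>\<^bsub>_\<^esub> _)\<close> [71, 0, 71] 70)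
  assumes cprod_add_left: "(a + b) \<odot>\<^bsub>n\<^esub> c = a \<odot>\<^bsub>n\<^esub> c + b \<odot>\<^bsub>n\<^esub> c"
    and cprod_add_right: "a \<odot>\<^bsub>n\<^esub> (b + c) = a \<odot>\<^bsub>n\<^esub> b + a \<odot>\<^bsub>n\<^esub> c"
    and cprod_scale_left: "(r \<bullet>\<^sub>c a) \<odot>\<^bsub>n\<^esub> b = r \<bullet>\<^sub>c (a \<odot>\<^bsub>n\<^esub> b)"
    and cprod_scale_right: "a \<odot>\<^bsub>n\<^esub> (r \<bullet>\<^sub>c b) = r \<bullet>\<^sub>c (a \<odot>\<^bsub>n\<^esub> b)"
    and locality: "\<exists>N. \<forall>n\<ge>N. a \<odot>\<^bsub>n\<^esub> b = 0"
    and del_cprod: "\<partial> (a \<odot>\<^bsub>n\<^esub> b) = (\<partial> a) \<odot>\<^bsub>n\<^esub> b + a \<odot>\<^bsub>n\<^esub> (\<partial> b)"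
    and cprod_del_left: "(\<partial> a) \<odot>\<^bsub>n\<^esub> b = - of_nat n \<bullet>\<^sub>c (a \<odot>\<^bsub>n - 1\<^esub> b)"
      \<comment> \<open>for \<open>n = 0\<close> the scalar vanishes, so the truncated subtraction is harmless\<close>

lemma cprod_zero_left [simp]: "(0 :: 'a :: conformal_algebra) \<odot>\<^bsub>n\<^esub> b = 0"
  using cprod_add_left[of 0 0 n b] by simp

lemma cprod_zero_right [simp]: "(a :: 'a :: conformal_algebra) \<odot>\<^bsub>n\<^esub> 0 = 0"
  using cprod_add_right[of a n 0 0] by simp

lemma cprod_minus_left: "(- a) \<odot>\<^bsub>n\<^esub> b = - ((a :: 'a :: conformal_algebra) \<odot>\<^bsub>n\<^esub> b)"
  using cprod_add_left[of a "- a" n b] by (simp add: minus_unique)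

lemma cprod_del_right:
  "a \<odot>\<^bsub>n\<^esub> (\<partial> b) = \<partial> ((a :: 'a :: conformal_algebra) \<odot>\<^bsub>n\<^esub> b) + of_nat n \<bullet>\<^sub>c (a \<odot>\<^bsub>n - 1\<^esub> b)"
  by (simp add: del_cprod cprod_del_left)

lemma finite_cprod_support: "finite {n. (a :: 'a :: conformal_algebra) \<odot>\<^bsub>n\<^esub> b \<noteq> 0}"
proof -
  obtain N where "\<forall>n\<ge>N. a \<odot>\<^bsub>n\<^esub> b = 0" using locality by blast
  then have "{n. a \<odot>\<^bsub>n\<^esub> b \<noteq> 0} \<subseteq> {..<N}" by (auto simp: not_le[symmetric])
  then show ?thesis by (rule finite_subset) simp
qed


section \<open>The coefficient algebra\<close>

text \<open>
  Laurent polynomials \<open>C[t, t\<^sup>-\<^sup>1]\<close> are finitely supported functions \<open>int \<Rightarrow>\<^sub>0 'a\<close>, with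
  \<open>a t\<^sup>l\<close> represented by \<open>Poly_Mapping.single l a\<close>.
\<close>

abbreviation mono_t :: "int \<Rightarrow> 'a \<Rightarrow> int \<Rightarrow>\<^sub>0 'a :: zero"
  where "mono_t \<equiv> Poly_Mapping.single"

definition tder :: "(int \<Rightarrow>\<^sub>0 'a) \<Rightarrow> int \<Rightarrow>\<^sub>0 'a :: cpoly_module"  \<comment> \<open>\<open>\<partial> + d/dt\<close>\<close>
  where "tder f = (\<Sum>l\<in>Poly_Mapping.keys f.
           mono_t l (\<partial> (Poly_Mapping.lookup f l)) +
           mono_t (l - 1) (of_int l \<bullet>\<^sub>c Poly_Mapping.lookup f l))"

definition lscale :: "complex \<Rightarrow> (int \<Rightarrow>\<^sub>0 'a) \<Rightarrow> int \<Rightarrow>\<^sub>0 'a :: cpoly_module"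
  where "lscale c f = Poly_Mapping.map (cscale c) f"

text \<open>
  The product \<open>\<circ>\<^sub>0\<close> on \<open>C[t, t\<^sup>-\<^sup>1]\<close>, first on monomials (the sum is finite by locality), then
  extended bilinearly.
\<close>

definition lmono :: "int \<Rightarrow> 'a \<Rightarrow> int \<Rightarrow> 'a \<Rightarrow> int \<Rightarrow>\<^sub>0 'a :: conformal_algebra"
  where "lmono l a m b =
    Sum_any (\<lambda>j. mono_t (l + m - int j) ((of_int l gchoose j) \<bullet>\<^sub>c (a \<odot>\<^bsub>j\<^esub> b)))"

definition lmult :: "(int \<Rightarrow>\<^sub>0 'a) \<Rightarrow> (int \<Rightarrow>\<^sub>0 'a) \<Rightarrow> int \<Rightarrow>\<^sub>0 'a :: conformal_algebra"
  where "lmult f g = (\<Sum>l\<in>Poly_Mapping.keys f. \<Sum>m\<in>Poly_Mapping.keys g.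
    lmono l (Poly_Mapping.lookup f l) m (Poly_Mapping.lookup g m))"

lemma sum_keys_superset:
  fixes \<phi> :: "'i \<Rightarrow> 'a :: comm_monoid_add \<Rightarrow> 'b :: comm_monoid_add"
  assumes "\<And>l. \<phi> l 0 = 0" "finite A" "Poly_Mapping.keys f \<subseteq> A"
  shows "(\<Sum>l\<in>Poly_Mapping.keys f. \<phi> l (Poly_Mapping.lookup f l)) =
    (\<Sum>l\<in>A. \<phi> l (Poly_Mapping.lookup f l))"
  by (rule sum.mono_neutral_left) (use assms in \<open>auto simp: in_keys_iff\<close>)

lemma sum_keys_add:
  fixes \<phi> :: "'i \<Rightarrow> 'a :: comm_monoid_add \<Rightarrow> 'b :: comm_monoid_add"
  assumes "\<And>l. \<phi> l 0 = 0" "\<And>l x y. \<phi> l (x + y) = \<phi> l x + \<phi> l y"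
  shows "(\<Sum>l\<in>Poly_Mapping.keys (f + g). \<phi> l (Poly_Mapping.lookup (f + g) l)) =
    (\<Sum>l\<in>Poly_Mapping.keys f. \<phi> l (Poly_Mapping.lookup f l)) +
    (\<Sum>l\<in>Poly_Mapping.keys g. \<phi> l (Poly_Mapping.lookup g l))"
proof -
  let ?A = "Poly_Mapping.keys f \<union> Poly_Mapping.keys g"
  show ?thesis
    unfolding sum_keys_superset[of \<phi> ?A f, OF assms(1) finite_UnI[OF finite_keys finite_keys] Un_upper1]
      sum_keys_superset[of \<phi> ?A g, OF assms(1) finite_UnI[OF finite_keys finite_keys] Un_upper2]
      sum_keys_superset[of \<phi> ?A "f + g", OF assms(1) finite_UnI[OF finite_keys finite_keys] keys_add]
    by (simp only: lookup_add assms(2) sum.distrib)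
qed

lemma laurent_induct [case_names mono add]:
  assumes "\<And>l a. P (mono_t l a)" "\<And>f g. P f \<Longrightarrow> P g \<Longrightarrow> P (f + g)"
  shows "P (f :: int \<Rightarrow>\<^sub>0 'a :: comm_monoid_add)"
proof (induction f rule: update_induct)
  case const
  show ?case using assms(1)[of 0 0] by simp
next
  case (update f l a)
  have "Poly_Mapping.update l a f = f + mono_t l a"
    using update.hyps
    by (intro poly_mapping_eqI)
       (auto simp: lookup_update lookup_add lookup_single when_def in_keys_iff)
  then show ?case using update.IH assms by simp
qed

lemma tder_add: "tder (f + g) = tder f + tder g"
  unfolding tder_def
  by (rule sum_keys_add)
    (simp_all add: del_add single_add pmv.scale_right_distrib algebra_simps)

lemma tder_mono: "tder (mono_t l a) = mono_t l (\<partial> a) + mono_t (l - 1) (of_int l \<bullet>\<^sub>c a)"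
  by (simp add: tder_def)

lemma tder_zero [simp]: "tder 0 = 0"
  by (simp add: tder_def)

lemma tder_minus: "tder (- f) = - tder f"
  using tder_add[of f "- f"] by (simp add: minus_unique)

lemma tder_diff: "tder (f - g) = tder f - tder g"
  using tder_add[of f "- g"] by (simp add: tder_minus)

lemma lookup_lscale [simp]:
  "Poly_Mapping.lookup (lscale c f) k = c \<bullet>\<^sub>c Poly_Mapping.lookup f k"
  by (simp add: lscale_def map.rep_eq when_def)

lemma lscale_add: "lscale c (f + g) = lscale c f + lscale c g"
  by (rule poly_mapping_eqI) (simp add: lookup_add pmv.scale_right_distrib)

lemma lscale_zero [simp]: "lscale c 0 = 0"
  by (rule poly_mapping_eqI) simp

lemma lscale_mono [simp]: "lscale c (mono_t l a) = mono_t l (c \<bullet>\<^sub>c a)"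
  by (rule poly_mapping_eqI) (simp add: lookup_single when_def)

lemma lscale_sum: "lscale c (sum f A) = (\<Sum>i\<in>A. lscale c (f i))"
  by (induction A rule: infinite_finite_induct) (simp_all add: lscale_add)

lemma lscale_tder: "lscale c (tder f) = tder (lscale c f)"
proof (induction f rule: laurent_induct)
  case (mono l a)
  show ?case by (simp add: tder_mono lscale_add del_cscale mult.commute)
qed (simp_all add: tder_add lscale_add)

lemma lscale_diff: "lscale c (f - g) = lscale c f - lscale c g"
  by (rule poly_mapping_eqI) (simp add: lookup_minus pmv.scale_right_diff_distrib)

lemma lmono_eq_sum:
  assumes "\<forall>j\<ge>N. a \<odot>\<^bsub>j\<^esub> b = 0"
  shows "lmono l a m b =
    (\<Sum>j<N. mono_t (l + m - int j) ((of_int l gchoose j) \<bullet>\<^sub>c (a \<odot>\<^bsub>j\<^esub> b)))"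
  unfolding lmono_def
  by (rule Sum_any.expand_superset) (use assms in \<open>force simp: not_le[symmetric]\<close>)+

lemma finite_lmono_support:
  "finite {j. mono_t (l + m - int j) ((of_int l gchoose j) \<bullet>\<^sub>c (a \<odot>\<^bsub>j\<^esub> b)) \<noteq>
     (0 :: int \<Rightarrow>\<^sub>0 'a :: conformal_algebra)}"
  by (rule finite_subset[OF _ finite_cprod_support[of a b]]) auto

lemma lmono_zero [simp]: "lmono l 0 m b = 0" "lmono l a m 0 = 0"
  by (simp_all add: lmono_def)

lemma lmono_add_left: "lmono l (a + a') m b = lmono l a m b + lmono l a' m b"
  unfolding lmono_def
  by (subst Sum_any.distrib[symmetric, OF finite_lmono_support finite_lmono_support])
    (simp add: cprod_add_left pmv.scale_right_distrib single_add)

lemma lmono_add_right: "lmono l a m (b + b') = lmono l a m b + lmono l a m b'"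
  unfolding lmono_def
  by (subst Sum_any.distrib[symmetric, OF finite_lmono_support finite_lmono_support])
    (simp add: cprod_add_right pmv.scale_right_distrib single_add)

lemma lmono_scale:
  "lmono l (c \<bullet>\<^sub>c a) m b = lscale c (lmono l a m b)"
  "lmono l a m (c \<bullet>\<^sub>c b) = lscale c (lmono l a m b)"
proof -
  obtain N where N: "\<forall>j\<ge>N. a \<odot>\<^bsub>j\<^esub> b = 0" using locality by blast
  have N1: "\<forall>j\<ge>N. (c \<bullet>\<^sub>c a) \<odot>\<^bsub>j\<^esub> b = 0" using N by (simp add: cprod_scale_left)
  have N2: "\<forall>j\<ge>N. a \<odot>\<^bsub>j\<^esub> (c \<bullet>\<^sub>c b) = 0" using N by (simp add: cprod_scale_right)
  show "lmono l (c \<bullet>\<^sub>c a) m b = lscale c (lmono l a m b)"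
    by (simp add: lmono_eq_sum[OF N] lmono_eq_sum[OF N1] lscale_sum cprod_scale_left mult.commute)
  show "lmono l a m (c \<bullet>\<^sub>c b) = lscale c (lmono l a m b)"
    by (simp add: lmono_eq_sum[OF N] lmono_eq_sum[OF N2] lscale_sum cprod_scale_right mult.commute)
qed

lemma lmult_add_left: "lmult (f + f') g = lmult f g + lmult f' g"
  unfolding lmult_def
  by (rule sum_keys_add) (simp_all add: lmono_add_left sum.distrib)

lemma lmult_add_right: "lmult f (g + g') = lmult f g + lmult f g'"
  unfolding lmult_def
  by (subst sum.distrib[symmetric], intro sum.cong refl sum_keys_add)
    (simp_all add: lmono_add_right)

lemma lmult_mono: "lmult (mono_t l a) (mono_t m b) = lmono l a m b"
  by (simp add: lmult_def)

lemma lmult_zero [simp]: "lmult 0 g = 0" "lmult f 0 = 0"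
  by (simp_all add: lmult_def)

lemma lmult_minus: "lmult (- f) g = - lmult f g" "lmult f (- g) = - lmult f g"
  using lmult_add_left[of f "- f" g] lmult_add_right[of f g "- g"]
  by (simp_all only: add.right_inverse lmult_zero minus_unique[symmetric])

lemma lmult_diff: "lmult (f - f') g = lmult f g - lmult f' g" "lmult f (g - g') = lmult f g - lmult f g'"
  using lmult_add_left[of f "- f'" g] lmult_add_right[of f g "- g'"] by (simp_all add: lmult_minus)

lemma lmult_scale: "lmult (lscale c f) g = lscale c (lmult f g)" "lmult f (lscale c g) = lscale c (lmult f g)"
proof -
  have *: "lmult (lscale c (mono_t l a)) g = lscale c (lmult (mono_t l a) g)
      \<and> lmult (mono_t l a) (lscale c g) = lscale c (lmult (mono_t l a) g)" for l a
    by (induction g rule: laurent_induct)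
      (simp_all add: lmult_mono lmono_scale lmult_add_right lscale_add del: lscale_mono,
       simp_all add: lmult_mono lmono_scale)
  show "lmult (lscale c f) g = lscale c (lmult f g)"
    by (induction f rule: laurent_induct) (use * in \<open>simp_all add: lmult_add_left lscale_add\<close>)
  show "lmult f (lscale c g) = lscale c (lmult f g)"
    by (induction f rule: laurent_induct) (use * in \<open>simp_all add: lmult_add_left lscale_add\<close>)
qed


text \<open>The image of \<open>\<partial> + d/dt\<close> is a two-sided ideal, so that the product descends to the quotient.\<close>

lemma lmult_tder_left: "lmult (tder f) g = 0"
proof -
  have mono: "lmono l (\<partial> a) m b + lmono (l - 1) (of_int l \<bullet>\<^sub>c a) m b = 0"
    for l m and a b :: 'a
  proof -
    obtain N where N: "\<forall>j\<ge>N. a \<odot>\<^bsub>j\<^esub> b = 0" using locality by blast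
    have N': "\<forall>j\<ge>Suc N. (\<partial> a) \<odot>\<^bsub>j\<^esub> b = 0" using N by (simp add: cprod_del_left)
    have coef: "(of_int l gchoose Suc j) * (1 + complex_of_nat j) = of_int l * (of_int l - 1 gchoose j)"
      for j using gbinomial_absorption[of j "of_int l :: complex"] by (simp add: mult.commute)
    have step: "mono_t (l + m - int (Suc j)) ((of_int l gchoose Suc j) \<bullet>\<^sub>c ((\<partial> a) \<odot>\<^bsub>Suc j\<^esub> b)) =
      - mono_t (l + m - int j - 1) ((of_int l * (of_int l - 1 gchoose j)) \<bullet>\<^sub>c (a \<odot>\<^bsub>j\<^esub> b))" for j
    proof -
      have "l + m - int (Suc j) = l + m - int j - 1" by simp
      moreover have "(of_int l gchoose Suc j) \<bullet>\<^sub>c ((\<partial> a) \<odot>\<^bsub>Suc j\<^esub> b) =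
          - ((of_int l * (of_int l - 1 gchoose j)) \<bullet>\<^sub>c (a \<odot>\<^bsub>j\<^esub> b))"
        unfolding cprod_del_left coef[symmetric]
        by (simp add: ring_distribs flip: pmv.scale_minus_left)
      ultimately show ?thesis by (simp only: single_uminus)
    qed
    have "lmono l (\<partial> a) m b =
      (\<Sum>j<N. - mono_t (l + m - int j - 1) ((of_int l * (of_int l - 1 gchoose j)) \<bullet>\<^sub>c (a \<odot>\<^bsub>j\<^esub> b)))"
      unfolding lmono_eq_sum[OF N'] sum.lessThan_Suc_shift step
      by (simp add: cprod_del_left)
    moreover have "lmono (l - 1) (of_int l \<bullet>\<^sub>c a) m b =
      (\<Sum>j<N. mono_t (l + m - int j - 1) ((of_int l * (of_int l - 1 gchoose j)) \<bullet>\<^sub>c (a \<odot>\<^bsub>j\<^esub> b)))"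
      unfolding lmono_scale lmono_eq_sum[OF N] lscale_sum by (simp add: algebra_simps)
    ultimately show ?thesis by (simp add: sum_negf)
  qed
  have "lmult (tder (mono_t l a)) g = 0" for l a
    by (induction g rule: laurent_induct)
      (simp_all add: tder_mono lmult_add_left lmult_add_right lmult_mono mono)
  then show ?thesis
    by (induction f rule: laurent_induct) (simp_all add: tder_add lmult_add_left)
qed

lemma tder_sum: "tder (sum f A) = (\<Sum>i\<in>A. tder (f i))"
  by (induction A rule: infinite_finite_induct) (simp_all add: tder_add)

lemma lmult_tder_right: "lmult f (tder g) = tder (lmult f g)"
proof -
  have mono: "lmono l a m (\<partial> b) + lmono l a (m - 1) (of_int m \<bullet>\<^sub>c b) = tder (lmono l a m b)"
    for l m and a b :: 'a
  proof -
    obtain N where N: "\<forall>j\<ge>N. a \<odot>\<^bsub>j\<^esub> b = 0" using locality by blast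
    have N': "\<forall>j\<ge>Suc N. a \<odot>\<^bsub>j\<^esub> (\<partial> b) = 0" using N by (simp add: cprod_del_right)
    define T where "T j = mono_t (l + m - int j) ((of_int l gchoose j) \<bullet>\<^sub>c \<partial> (a \<odot>\<^bsub>j\<^esub> b))" for j
    define S where "S c j = mono_t (l + m - int j - 1) ((c * (of_int l gchoose j)) \<bullet>\<^sub>c (a \<odot>\<^bsub>j\<^esub> b))"
      for c :: complex and j
    have TN: "T N = 0" by (simp add: T_def N)
    have S_add: "S c j + S d j = S (c + d) j" for c d j
      by (simp add: S_def flip: single_add) (simp add: ring_distribs pmv.scale_left_distrib)
    have coef: "(of_int l gchoose Suc j) * (1 + complex_of_nat j) =
        (of_int l - of_nat j) * (of_int l gchoose j)" for j
      using gbinomial_absorption[of j "of_int l :: complex"]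
        gbinomial_absorb_comp[of "of_int l :: complex" j] by (simp add: mult.commute)
    have "lmono l a m (\<partial> b) = (\<Sum>j<Suc N. T j) +
        (\<Sum>j<Suc N. mono_t (l + m - int j) ((of_int l gchoose j) \<bullet>\<^sub>c of_nat j \<bullet>\<^sub>c (a \<odot>\<^bsub>j - 1\<^esub> b)))"
      unfolding lmono_eq_sum[OF N']
      by (simp only: cprod_del_right pmv.scale_right_distrib single_add sum.distrib T_def)
    also have "(\<Sum>j<Suc N. mono_t (l + m - int j) ((of_int l gchoose j) \<bullet>\<^sub>c of_nat j \<bullet>\<^sub>c (a \<odot>\<^bsub>j - 1\<^esub> b)))
        = (\<Sum>j<N. S (of_int l - of_nat j) j)"
      unfolding sum.lessThan_Suc_shift S_def
      by (simp add: coef) (simp add: algebra_simps)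
    finally have "lmono l a m (\<partial> b) = (\<Sum>j<N. T j) + (\<Sum>j<N. S (of_int l - of_nat j) j)"
      by (simp add: TN)
    moreover have "lmono l a (m - 1) (of_int m \<bullet>\<^sub>c b) = (\<Sum>j<N. S (of_int m) j)"
      unfolding lmono_scale lmono_eq_sum[OF N] lscale_sum S_def by (simp add: algebra_simps)
    moreover have "tder (lmono l a m b) = (\<Sum>j<N. T j) + (\<Sum>j<N. S (of_int l - of_nat j + of_int m) j)"
      unfolding lmono_eq_sum[OF N] tder_sum tder_mono S_def T_def sum.distrib
      by (simp add: del_cscale algebra_simps)
    ultimately show ?thesis by (simp add: sum.distrib[symmetric] S_add add.assoc)
  qed
  have *: "lmult (mono_t l a) (tder g) = tder (lmult (mono_t l a) g)" for l a
    by (induction g rule: laurent_induct)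
      (simp_all add: tder_mono tder_add lmult_add_right lmult_mono mono)
  then show ?thesis
    by (induction f rule: laurent_induct) (simp_all add: tder_add lmult_add_left)
qed

definition coeff_rel :: "(int \<Rightarrow>\<^sub>0 'a) \<Rightarrow> (int \<Rightarrow>\<^sub>0 'a :: conformal_algebra) \<Rightarrow> bool"
  where "coeff_rel f g \<longleftrightarrow> f - g \<in> range tder"

lemma coeff_rel_iff: "coeff_rel f g \<longleftrightarrow> (\<exists>h. f = g + tder h)"
  by (auto simp: coeff_rel_def image_iff algebra_simps)

quotient_type (overloaded) 'a coeff = "int \<Rightarrow>\<^sub>0 'a :: conformal_algebra" / coeff_rel
proof (rule equivpI)
  show "reflp coeff_rel"
    by (auto simp: reflp_def coeff_rel_iff intro: exI[of _ 0])
  show "symp coeff_rel"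
  proof (rule sympI)
    fix f g assume "coeff_rel f g"
    then obtain h where "f = g + tder h" by (auto simp: coeff_rel_iff)
    then have "g = f + tder (- h)" by (simp add: tder_minus)
    then show "coeff_rel g f" unfolding coeff_rel_iff by blast
  qed
  show "transp coeff_rel"
  proof (rule transpI)
    fix f g k assume "coeff_rel f g" "coeff_rel g k"
    then obtain h h' where "f = g + tder h" "g = k + tder h'" by (auto simp: coeff_rel_iff)
    then have "f = k + tder (h' + h)" by (simp add: tder_add add.assoc)
    then show "coeff_rel f k" unfolding coeff_rel_iff by blast
  qed
qed

instantiation coeff :: (conformal_algebra) "{ab_group_add, times}"
begin

lift_definition zero_coeff :: "'a coeff" is 0 .

lift_definition plus_coeff :: "'a coeff \<Rightarrow> 'a coeff \<Rightarrow> 'a coeff" is "(+)"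
proof -
  fix f f' g g' :: "int \<Rightarrow>\<^sub>0 'a" assume "coeff_rel f f'" "coeff_rel g g'"
  then obtain h k where "f = f' + tder h" "g = g' + tder k" by (auto simp: coeff_rel_iff)
  then have "f + g = f' + g' + tder (h + k)" by (simp add: tder_add)
  then show "coeff_rel (f + g) (f' + g')" unfolding coeff_rel_iff by blast
qed

lift_definition uminus_coeff :: "'a coeff \<Rightarrow> 'a coeff" is "uminus"
proof -
  fix f f' :: "int \<Rightarrow>\<^sub>0 'a" assume "coeff_rel f f'"
  then obtain h where "f = f' + tder h" by (auto simp: coeff_rel_iff)
  then have "- f = - f' + tder (- h)" by (simp add: tder_minus)
  then show "coeff_rel (- f) (- f')" unfolding coeff_rel_iff by blast
qed

lift_definition minus_coeff :: "'a coeff \<Rightarrow> 'a coeff \<Rightarrow> 'a coeff" is "(-)"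
proof -
  fix f f' g g' :: "int \<Rightarrow>\<^sub>0 'a" assume "coeff_rel f f'" "coeff_rel g g'"
  then obtain h k where "f = f' + tder h" "g = g' + tder k" by (auto simp: coeff_rel_iff)
  then have "f - g = f' - g' + tder (h - k)" by (simp add: tder_diff)
  then show "coeff_rel (f - g) (f' - g')" unfolding coeff_rel_iff by blast
qed

lift_definition times_coeff :: "'a coeff \<Rightarrow> 'a coeff \<Rightarrow> 'a coeff" is lmult
proof -
  fix f f' g g' :: "int \<Rightarrow>\<^sub>0 'a" assume "coeff_rel f f'" "coeff_rel g g'"
  then obtain h k where "f = f' + tder h" "g = g' + tder k" by (auto simp: coeff_rel_iff)
  then have "lmult f g = lmult f' g' + tder (lmult f' k)"
    by (simp add: lmult_add_left lmult_add_right lmult_tder_left lmult_tder_right tder_add)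
  then show "coeff_rel (lmult f g) (lmult f' g')" unfolding coeff_rel_iff by blast
qed

instance
proof
  fix x y z :: "'a coeff"
  have refl: "coeff_rel f f" for f :: "int \<Rightarrow>\<^sub>0 'a"
    by (auto simp: coeff_rel_iff intro: exI[of _ 0])
  show "x + y + z = x + (y + z)" by transfer (simp add: add.assoc refl)
  show "x + y = y + x" by transfer (simp add: add.commute refl)
  show "0 + x = x" by transfer (simp add: refl)
  show "- x + x = 0" by transfer (simp add: refl)
  show "x - y = x + - y" by transfer (simp add: refl)
qed

end

lift_definition coeff_scale :: "complex \<Rightarrow> 'a coeff \<Rightarrow> 'a :: conformal_algebra coeff" is lscale
proof -
  fix c and f f' :: "int \<Rightarrow>\<^sub>0 'a" assume "coeff_rel f f'"
  then obtain h where "f = f' + tder h" by (auto simp: coeff_rel_iff)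
  then have "lscale c f = lscale c f' + tder (lscale c h)" by (simp add: lscale_add lscale_tder)
  then show "coeff_rel (lscale c f) (lscale c f')" unfolding coeff_rel_iff by blast
qed

text \<open>The argument only fixes the type carrying the conformal algebra.\<close>

definition assoc_conformal :: "'a :: conformal_algebra itself \<Rightarrow> bool"
  where "assoc_conformal T \<longleftrightarrow> (\<forall>x y z :: 'a coeff. (x * y) * z = x * (y * z))"


section \<open>Gelfand-Kirillov dimension of ordinary algebras\<close>

locale cplx_algebra = vector_space scale
  for scale :: "complex \<Rightarrow> 'b :: {ab_group_add, times} \<Rightarrow> 'b"  (infixr \<open>\<cdot>\<^sub>s\<close> 75) +
  assumes mult_add_left: "(x + y) * z = x * z + y * z"
    and mult_add_right: "x * (y + z) = x * y + x * z"
    and mult_scale_left: "(c \<cdot>\<^sub>s x) * y = c \<cdot>\<^sub>s (x * y)"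
    and mult_scale_right: "x * (c \<cdot>\<^sub>s y) = c \<cdot>\<^sub>s (x * y)"
begin

definition subalgebra :: "'b set \<Rightarrow> bool"
  where "subalgebra S \<longleftrightarrow> subspace S \<and> (\<forall>x\<in>S. \<forall>y\<in>S. x * y \<in> S)"

definition generated :: "'b set \<Rightarrow> 'b set"
  where "generated V = subalgebra hull V"

definition fin_dim_subspace :: "'b set \<Rightarrow> bool"
  where "fin_dim_subspace V \<longleftrightarrow> (\<exists>B. finite B \<and> V = span B)"

text \<open>
  \<open>vpow V k\<close> is the power \<open>V\<^sup>k\<^sup>+\<^sup>1\<close>; there is no \<open>V\<^sup>0\<close> since the algebra need not be unital.
  Associativity is not part of the locale, as the coefficient algebra of a general conformal
  algebra is not associative; for associative algebras the left-normed bracketing is immaterial.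
\<close>

primrec vpow :: "'b set \<Rightarrow> nat \<Rightarrow> 'b set"
  where
    "vpow V 0 = V"
  | "vpow V (Suc k) = span {x * y | x y. x \<in> vpow V k \<and> y \<in> V}"

definition filt :: "'b set \<Rightarrow> nat \<Rightarrow> 'b set"  \<comment> \<open>\<open>V\<^sup>1 + \<dots> + V\<^sup>r\<close>\<close>
  where "filt V r = span (\<Union>k<r. vpow V k)"

text \<open>In the degenerate case \<open>V = 0\<close> the convention \<^prop>\<open>ln (0 :: real) = 0\<close> gives growth \<open>0\<close>.\<close>

definition growth :: "'b set \<Rightarrow> ereal"
  where "growth V = limsup (\<lambda>r. ereal (ln (real (dim (filt V r))) / ln (real r)))"

text \<open>
  In an associative algebra the growth of \<open>V\<close> depends only on the subalgebra generated by \<open>V\<close> and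
  is monotone in it. Hence the formula below yields \<open>growth V\<close> when \<open>S\<close> is generated by \<open>V\<close>, and in
  general the supremum over the finitely generated subalgebras of \<open>S\<close>; this is proved in
  \<open>GKdim_generated\<close> and \<open>GKdim_eq_SUP\<close>.
\<close>

definition GKdim :: "'b set \<Rightarrow> ereal"
  where "GKdim S = (SUP V \<in> {V. fin_dim_subspace V \<and> V \<subseteq> S}. growth V)"

end

lemma coeff_rel_refl: "coeff_rel f f"
  by (auto simp: coeff_rel_iff intro: exI[of _ 0])

lemma coeff_eqI: "f = g \<Longrightarrow> coeff_rel f g"
  by (simp add: coeff_rel_refl)

global_interpretation coeff: cplx_algebra "coeff_scale :: complex \<Rightarrow> 'a :: conformal_algebra coeff \<Rightarrow> 'a coeff"
proof
  fix a b :: complex and x y z :: "'a coeff"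
  show "coeff_scale a (x + y) = coeff_scale a x + coeff_scale a y"
    by transfer (rule coeff_eqI, rule lscale_add)
  show "coeff_scale (a + b) x = coeff_scale a x + coeff_scale b x"
    by transfer (rule coeff_eqI, rule poly_mapping_eqI, simp add: lookup_add pmv.scale_left_distrib)
  show "coeff_scale a (coeff_scale b x) = coeff_scale (a * b) x"
    by transfer (rule coeff_eqI, rule poly_mapping_eqI, simp)
  show "coeff_scale 1 x = x"
    by transfer (rule coeff_eqI, rule poly_mapping_eqI, simp)
  show "(x + y) * z = x * z + y * z"
    by transfer (rule coeff_eqI, rule lmult_add_left)
  show "x * (y + z) = x * y + x * z"
    by transfer (rule coeff_eqI, rule lmult_add_right)
  show "coeff_scale a x * y = coeff_scale a (x * y)"
    by transfer (rule coeff_eqI, rule lmult_scale)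
  show "x * coeff_scale a y = coeff_scale a (x * y)"
    by transfer (rule coeff_eqI, rule lmult_scale)
qed


section \<open>Gelfand-Kirillov dimension of conformal algebras\<close>

definition conf_subalgebra :: "'a :: conformal_algebra set \<Rightarrow> bool"
  where "conf_subalgebra S \<longleftrightarrow> pm.subspace S \<and> (\<forall>x\<in>S. \<forall>y\<in>S. \<forall>n. x \<odot>\<^bsub>n\<^esub> y \<in> S)"

definition conf_generated :: "'a :: conformal_algebra set \<Rightarrow> 'a set"
  where "conf_generated F = conf_subalgebra hull F"

text \<open>\<open>conf_word F n x\<close>: \<open>x\<close> is a product of exactly \<open>n\<close> elements of \<open>F\<close>.\<close>

inductive conf_word :: "'a :: conformal_algebra set \<Rightarrow> nat \<Rightarrow> 'a \<Rightarrow> bool" for F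
  where
    gen: "x \<in> F \<Longrightarrow> conf_word F 1 x"
  | prod: "conf_word F m x \<Longrightarrow> conf_word F n y \<Longrightarrow> conf_word F (m + n) (x \<odot>\<^bsub>k\<^esub> y)"

definition conf_filt :: "'a :: conformal_algebra set \<Rightarrow> nat \<Rightarrow> 'a set"
  where "conf_filt F r = pm.span {x. \<exists>n\<le>r. conf_word F n x}"

text \<open>
  The supremum is a maximum for subsets of finitely generated modules, see \<open>pm_rank_attained\<close>.
\<close>

definition pm_rank :: "'a :: cpoly_module set \<Rightarrow> nat"
  where "pm_rank S = Sup (card ` {B. finite B \<and> B \<subseteq> S \<and> pm.independent B})"

text \<open>If all ranks are \<open>0\<close>, the convention \<^prop>\<open>ln (0 :: real) = 0\<close> gives growth \<open>0\<close>.\<close>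

definition conf_growth :: "'a :: conformal_algebra set \<Rightarrow> ereal"
  where "conf_growth F = limsup (\<lambda>r. ereal (ln (real (pm_rank (conf_filt F r))) / ln (real r)))"

text \<open>
  As for ordinary algebras, this is \<open>conf_growth F\<close> when \<open>S\<close> is generated by the finite set \<open>F\<close>, and
  in general the supremum over the finitely generated conformal subalgebras of \<open>S\<close>; this is proved
  in \<open>conf_GKdim_generated\<close> and \<open>conf_GKdim_eq_SUP\<close>.
\<close>

definition conf_GKdim :: "'a :: conformal_algebra set \<Rightarrow> ereal"
  where "conf_GKdim S = (SUP F \<in> {F. finite F \<and> F \<subseteq> S}. conf_growth F)"


section \<open>Independence of the choice of generators\<close>

lemma limsup_ln_growth_le:
  fixes f g :: "nat \<Rightarrow> nat"
  assumes "s \<ge> 1" and le: "\<And>r. f r \<le> g (r * s)"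
  shows "limsup (\<lambda>r. ereal (ln (real (f r)) / ln (real r))) \<le>
    limsup (\<lambda>r. ereal (ln (real (g r)) / ln (real r)))"
proof (rule dense_ge)
  fix w assume w: "limsup (\<lambda>r. ereal (ln (real (g r)) / ln (real r))) < w"
  show "limsup (\<lambda>r. ereal (ln (real (f r)) / ln (real r))) \<le> w"
  proof (cases w)
    case (real c)
    have "eventually (\<lambda>r. ereal (ln (real (g r)) / ln (real r)) < w) sequentially"
      using w by (rule Limsup_lessD)
    then obtain R where R: "\<And>r. r \<ge> R \<Longrightarrow> ln (real (g r)) / ln (real r) < c"
      by (auto simp: eventually_sequentially real)
    have ln_mono: "ln (real a) \<le> ln (real b)" if "a \<le> b" for a b :: nat
      using that by (cases "a = 0"; cases "b = 0") auto
    have bound: "ln (real (f r)) / ln (real r) \<le> c * (ln (real s) / ln (real r) + 1)"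
      if r: "r \<ge> max R 2" for r
    proof -
      have rs: "r * s \<ge> R" "r * s \<ge> 2" using r \<open>s \<ge> 1\<close>
        by (metis dual_order.trans max.bounded_iff mult.right_neutral mult_le_mono2)+
      have "real (r * s) \<ge> 2" using rs(2) by (metis of_nat_le_iff of_nat_numeral)
      then have "real (r * s) > 1" by linarith
      then have pos: "ln (real (r * s)) > 0" "ln (real r) > 0" using r by (simp_all only: ln_gt_zero)
      have "ln (real (g (r * s))) \<le> c * ln (real (r * s))"
        using R[OF rs(1)] pos by (simp add: divide_less_eq)
      with ln_mono[OF le[of r]] have "ln (real (f r)) \<le> c * ln (real (r * s))" by linarith
      then have "ln (real (f r)) / ln (real r) \<le> c * ln (real (r * s)) / ln (real r)"
        using pos by (intro divide_right_mono) auto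
      also have "\<dots> = c * (ln (real s) / ln (real r) + 1)"
        using pos r \<open>s \<ge> 1\<close> by (simp add: ln_mult field_simps)
      finally show ?thesis .
    qed
    have lim0: "(\<lambda>r. ln (real s) / ln (real r)) \<longlonglongrightarrow> 0"
      by (rule real_tendsto_divide_at_top[OF tendsto_const
            filterlim_compose[OF ln_at_top filterlim_real_sequentially]])
    have "(\<lambda>r. c * (ln (real s) / ln (real r) + 1)) \<longlonglongrightarrow> c * (0 + 1)"
      by (rule tendsto_mult[OF tendsto_const tendsto_add[OF lim0 tendsto_const]])
    then have "limsup (\<lambda>r. ereal (c * (ln (real s) / ln (real r) + 1))) = ereal c"
      by (intro lim_imp_Limsup) auto
    moreover have "limsup (\<lambda>r. ereal (ln (real (f r)) / ln (real r))) \<le>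
        limsup (\<lambda>r. ereal (c * (ln (real s) / ln (real r) + 1)))"
      by (intro Limsup_mono eventually_sequentiallyI[of "max R 2"]) (simp add: bound)
    ultimately show ?thesis by (simp add: real)
  qed (use w in auto)
qed

context cplx_algebra
begin

lemma mult_zero [simp]: "0 * (x :: 'b) = 0" "(x :: 'b) * 0 = 0"
  using mult_add_left[of 0 0 x] mult_add_right[of x 0 0] by simp_all

lemma span_mult:
  assumes "\<And>x y. x \<in> A \<Longrightarrow> y \<in> B \<Longrightarrow> x * y \<in> span D" "x \<in> span A" "y \<in> span B"
  shows "x * y \<in> span D"
proof -
  have *: "x * y \<in> span D" if "x \<in> A" for x
    using assms(3)
    by (induction y rule: span_induct_alt)
      (auto simp: mult_add_right mult_scale_right intro!: span_add span_scale span_zero assms(1) that)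
  show ?thesis using assms(2)
    by (induction x rule: span_induct_alt)
      (auto simp: mult_add_left mult_scale_left intro!: span_add span_scale span_zero *)
qed

lemma subspace_fin_dim: "fin_dim_subspace V \<Longrightarrow> subspace V"
  by (auto simp: fin_dim_subspace_def)

lemma fin_dim_vpow: "fin_dim_subspace V \<Longrightarrow> fin_dim_subspace (vpow V k)"
proof (induction k)
  case (Suc k)
  obtain A B where A: "finite A" "vpow V k = span A" and B: "finite B" "V = span B"
    using Suc by (auto simp: fin_dim_subspace_def)
  let ?D = "(\<lambda>(x, y). x * y) ` (A \<times> B)"
  have "span {x * y | x y. x \<in> vpow V k \<and> y \<in> V} = span ?D"
  proof (rule span_eq[THEN iffD2], intro conjI subsetI)
    fix z assume "z \<in> {x * y | x y. x \<in> vpow V k \<and> y \<in> V}"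
    then obtain x y where xy: "z = x * y" "x \<in> span A" "y \<in> span B"
      unfolding A(2) using B(2) by blast
    have "x * y \<in> span ?D" if "x \<in> A" "y \<in> B" for x y
      using that by (intro span_base) auto
    from span_mult[OF this xy(2,3)] show "z \<in> span ?D" unfolding xy(1) .
  next
    fix z assume "z \<in> ?D"
    then obtain x y where xy: "z = x * y" "x \<in> A" "y \<in> B" by auto
    have "x \<in> vpow V k" using xy(2) by (simp only: A(2) span_base)
    moreover have "y \<in> V" using xy(3) by (simp only: B(2) span_base)
    ultimately have "z \<in> {x * y | x y. x \<in> vpow V k \<and> y \<in> V}" using xy(1) by blast
    then show "z \<in> span {x * y | x y. x \<in> vpow V k \<and> y \<in> V}" by (rule span_base)
  qed
  moreover have "finite ?D" using A(1) B(1) by simp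
  ultimately show ?case unfolding fin_dim_subspace_def vpow.simps by blast
qed auto

lemma fin_dim_filt: "fin_dim_subspace V \<Longrightarrow> fin_dim_subspace (filt V r)"
proof -
  assume V: "fin_dim_subspace V"
  have "\<forall>k. \<exists>B. finite B \<and> vpow V k = span B"
    using fin_dim_vpow[OF V] by (auto simp: fin_dim_subspace_def)
  then obtain B where B: "\<And>k. finite (B k)" "\<And>k. vpow V k = span (B k)" by metis
  have "filt V r = span (\<Union>k<r. B k)"
    unfolding filt_def
  proof (rule span_eq[THEN iffD2], intro conjI subsetI)
    fix z assume "z \<in> (\<Union>k<r. vpow V k)"
    then obtain k where "k < r" "z \<in> span (B k)" using B(2) by auto
    then show "z \<in> span (\<Union>k<r. B k)" using span_mono[of "B k" "\<Union>k<r. B k"] by auto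
  next
    fix z assume "z \<in> (\<Union>k<r. B k)"
    then show "z \<in> span (\<Union>k<r. vpow V k)" using B(2) by (auto intro!: span_base)
  qed
  then show ?thesis unfolding fin_dim_subspace_def using B(1) by (intro exI[of _ "\<Union>k<r. B k"]) auto
qed

lemma dim_mono_fin_dim:
  assumes "S \<subseteq> T" "fin_dim_subspace T"
  shows "dim S \<le> dim T"
proof -
  obtain A where A: "finite A" "T = span A" using assms(2) by (auto simp: fin_dim_subspace_def)
  obtain B where B: "B \<subseteq> T" "independent B" "T \<subseteq> span B" "card B = dim T"
    using basis_exists by blast
  have "finite B" using independent_span_bound[OF A(1) B(2)] B(1) A(2) by auto
  then show ?thesis using dim_le_card[of S B] assms(1) B by auto
qed

lemma subspace_filt: "subspace (filt V r)"
  by (simp add: filt_def)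

lemma filt_mono: "r \<le> s \<Longrightarrow> filt V r \<subseteq> filt V s"
  unfolding filt_def by (intro span_mono UN_mono) auto

context
  assumes assoc: "\<And>x y z :: 'b. (x * y) * z = x * (y * z)"
begin

lemma vpow_mult:
  assumes "x \<in> vpow V i" "y \<in> vpow V j"
  shows "x * y \<in> vpow V (Suc (i + j))"
  using assms(2)
proof (induction j arbitrary: y)
  case 0
  then show ?case using assms(1) by (auto intro!: span_base)
next
  case (Suc j)
  from Suc.prems have "y \<in> span {x * y | x y. x \<in> vpow V j \<and> y \<in> V}" by simp
  then have "x * y \<in> span {x * y | x y. x \<in> vpow V (Suc (i + j)) \<and> y \<in> V}"
  proof (induction y rule: span_induct_alt)
    case (step c u w)
    then obtain a b where ab: "u = a * b" "a \<in> vpow V j" "b \<in> V" by auto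
    have "x * u = (x * a) * b" using ab by (simp add: assoc)
    moreover have "x * a \<in> vpow V (Suc (i + j))" by (rule Suc.IH) (rule ab)
    ultimately have "x * u \<in> span {x * y | x y. x \<in> vpow V (Suc (i + j)) \<and> y \<in> V}"
      using ab(3) by (intro span_base) blast
    then show ?case using step by (auto simp: mult_add_right mult_scale_right intro!: span_add span_scale)
  qed (simp add: span_zero)
  then show ?case by simp
qed

lemma filt_mult:
  assumes "x \<in> filt V r" "y \<in> filt V s"
  shows "x * y \<in> filt V (r + s)"
  unfolding filt_def
proof (rule span_mult)
  show "x \<in> span (\<Union>k<r. vpow V k)" "y \<in> span (\<Union>k<s. vpow V k)" using assms by (auto simp: filt_def)
  fix x y assume "x \<in> (\<Union>k<r. vpow V k)" "y \<in> (\<Union>k<s. vpow V k)"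
  then obtain i j where "i < r" "j < s" "x \<in> vpow V i" "y \<in> vpow V j" by auto
  then show "x * y \<in> span (\<Union>k<r + s. vpow V k)"
    using vpow_mult[of x V i y j] by (intro span_base UN_I[of "Suc (i + j)"]) auto
qed

lemma generated_subset: "generated V \<subseteq> (\<Union>r. filt V r)"
proof -
  let ?U = "\<Union>r. filt V r"
  have "subalgebra ?U"
    unfolding subalgebra_def
  proof (intro conjI ballI)
    show "subspace ?U"
    proof (rule subspaceI)
      show "0 \<in> ?U" by (auto simp: filt_def span_zero)
      fix x y assume "x \<in> ?U" "y \<in> ?U"
      then obtain r s where "x \<in> filt V r" "y \<in> filt V s" by auto
      then have "x \<in> filt V (max r s)" "y \<in> filt V (max r s)"
        using filt_mono[of r "max r s" V] filt_mono[of s "max r s" V] by auto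
      then show "x + y \<in> ?U" unfolding filt_def by (blast intro: span_add)
    next
      fix c x assume "x \<in> ?U"
      then show "c \<cdot>\<^sub>s x \<in> ?U" unfolding filt_def by (blast intro: span_scale)
    qed
    fix x y assume "x \<in> ?U" "y \<in> ?U"
    then show "x * y \<in> ?U" using filt_mult by blast
  qed
  moreover have "V \<subseteq> filt V 1" by (simp add: filt_def span_superset lessThan_Suc)
  ultimately show ?thesis unfolding generated_def by (intro hull_minimal) blast+
qed

lemma growth_le:
  assumes V: "fin_dim_subspace V" and W: "fin_dim_subspace W" "W \<subseteq> generated V"
  shows "growth W \<le> growth V"
proof -
  obtain B where B: "finite B" "W = span B" using W(1) by (auto simp: fin_dim_subspace_def)
  have "\<forall>b\<in>B. \<exists>r. b \<in> filt V r" using W(2) B(2) generated_subset[of V] span_base by fastforce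
  then obtain r where r: "\<And>b. b \<in> B \<Longrightarrow> b \<in> filt V (r b)" by metis
  define s where "s = Suc (\<Sum>b\<in>B. r b)"
  have "b \<in> filt V s" if "b \<in> B" for b
  proof -
    have "r b \<le> s" using member_le_sum[of b B r] B(1) that by (simp add: s_def)
    then show ?thesis using r[OF that] filt_mono by blast
  qed
  then have Ws: "W \<subseteq> filt V s"
    unfolding B(2) filt_def by (intro span_minimal) auto
  have pow: "vpow W k \<subseteq> filt V (Suc k * s)" for k
  proof (induction k)
    case (Suc k)
    have "x * y \<in> filt V (Suc k * s + s)" if "x \<in> vpow W k" "y \<in> W" for x y
      using that Ws Suc by (intro filt_mult) auto
    then have "{x * y | x y. x \<in> vpow W k \<and> y \<in> W} \<subseteq> filt V (Suc k * s + s)" by blast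
    then have "vpow W (Suc k) \<subseteq> filt V (Suc k * s + s)"
      by (simp add: span_minimal subspace_filt)
    then show ?case by (simp add: add.commute add.left_commute)
  qed (use Ws in simp)
  have "filt W q \<subseteq> filt V (q * s)" for q
  proof -
    have "vpow W k \<subseteq> filt V (q * s)" if "k < q" for k
      using pow[of k] filt_mono[of "Suc k * s" "q * s" V] that mult_le_mono1[of "Suc k" q s] by auto
    then show ?thesis unfolding filt_def[of W] by (intro span_minimal) (auto simp: filt_def)
  qed
  then have "dim (filt W q) \<le> dim (filt V (q * s))" for q
    by (intro dim_mono_fin_dim fin_dim_filt V)
  then show ?thesis unfolding growth_def by (intro limsup_ln_growth_le[of s]) (auto simp: s_def)
qed

theorem GKdim_generated:
  assumes "fin_dim_subspace V"
  shows "GKdim (generated V) = growth V"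
  unfolding GKdim_def
proof (rule antisym)
  show "(SUP V \<in> {W. fin_dim_subspace W \<and> W \<subseteq> generated V}. growth V) \<le> growth V"
    by (intro SUP_least) (auto intro: growth_le assms)
  show "growth V \<le> (SUP V \<in> {W. fin_dim_subspace W \<and> W \<subseteq> generated V}. growth V)"
    using assms by (intro SUP_upper) (auto simp: generated_def hull_inc)
qed

theorem GKdim_eq_SUP:
  "GKdim S = (SUP V \<in> {V. fin_dim_subspace V \<and> V \<subseteq> S}. GKdim (generated V))"
  unfolding GKdim_def[of S] by (intro SUP_cong refl) (simp add: GKdim_generated)

end

end

lemma homogeneous_system_nontrivial_solution:
  fixes p :: "'i \<Rightarrow> 's \<Rightarrow> 'r :: idom"
  assumes "finite S" "finite I" "card S < card I"
  shows "\<exists>u. (\<exists>i\<in>I. u i \<noteq> 0) \<and> (\<forall>s\<in>S. (\<Sum>i\<in>I. u i * p i s) = 0)"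
  using assms
proof (induction S arbitrary: I p rule: finite_induct)
  case empty
  then have "I \<noteq> {}" by auto
  then show ?case by (intro exI[of _ "\<lambda>_. 1"]) auto
next
  case (insert s S)
  show ?case
  proof (cases "\<forall>i\<in>I. p i s = 0")
    case True
    have "card S < card I" using insert by simp
    from insert.IH[OF insert.prems(1) this, of p] True show ?thesis by auto
  next
    case False
    then obtain k where k: "k \<in> I" "p k s \<noteq> 0" by auto
    let ?q = "\<lambda>i x. p k s * p i x - p i s * p k x"
    have "card S < card (I - {k})" using insert k by simp
    from insert.IH[OF _ this, of ?q] insert.prems(1)
    obtain u where u: "\<exists>i\<in>I - {k}. u i \<noteq> 0" "\<And>x. x \<in> S \<Longrightarrow> (\<Sum>i\<in>I - {k}. u i * ?q i x) = 0"
      by auto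
    define v where "v i = (if i = k then - (\<Sum>i\<in>I - {k}. u i * p i s) else u i * p k s)" for i
    have expand: "(\<Sum>i\<in>I. v i * p i x) = (\<Sum>i\<in>I - {k}. u i * ?q i x)" for x
    proof -
      have "(\<Sum>i\<in>I. v i * p i x) = v k * p k x + (\<Sum>i\<in>I - {k}. v i * p i x)"
        using insert.prems(1) k(1) by (rule sum.remove)
      also have "\<dots> = (\<Sum>i\<in>I - {k}. u i * ?q i x)"
        by (simp add: v_def sum_distrib_right sum_distrib_left sum_subtractf algebra_simps)
      finally show ?thesis .
    qed
    have "(\<Sum>i\<in>I. v i * p i x) = 0" if "x \<in> insert s S" for x
      using that u(2)[of x] by (auto simp: expand mult.commute)
    moreover have "\<exists>i\<in>I. v i \<noteq> 0" using u(1) k by (auto simp: v_def)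
    ultimately show ?thesis by blast
  qed
qed

lemma pm_independent_card_le:
  fixes A B :: "'a :: cpoly_module set"
  assumes "finite A" "finite B" "B \<subseteq> pm.span A" "pm.independent B"
  shows "card B \<le> card A"
proof (rule ccontr)
  assume "\<not> card B \<le> card A"
  have "\<forall>b\<in>B. \<exists>p. b = (\<Sum>a\<in>A. p a \<bullet>\<^sub>p a)"
    using assms(1,3) by (auto simp: pm.span_finite)
  then obtain p where p: "\<And>b. b \<in> B \<Longrightarrow> b = (\<Sum>a\<in>A. p b a \<bullet>\<^sub>p a)" by metis
  obtain u where u: "\<exists>b\<in>B. u b \<noteq> 0" "\<And>a. a \<in> A \<Longrightarrow> (\<Sum>b\<in>B. u b * p b a) = 0"
    using homogeneous_system_nontrivial_solution[OF assms(1,2), of p] \<open>\<not> card B \<le> card A\<close> by auto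
  have "(\<Sum>b\<in>B. u b \<bullet>\<^sub>p b) = (\<Sum>b\<in>B. u b \<bullet>\<^sub>p (\<Sum>a\<in>A. p b a \<bullet>\<^sub>p a))"
    by (rule sum.cong[OF refl]) (simp only: p[symmetric])
  also have "\<dots> = (\<Sum>a\<in>A. (\<Sum>b\<in>B. u b * p b a) \<bullet>\<^sub>p a)"
    by (simp only: pm.scale_sum_right pm.scale_sum_left pscale_pscale) (rule sum.swap)
  also have "\<dots> = 0" by (simp add: u(2))
  finally have "pm.dependent B"
    unfolding pm.dependent_explicit using u(1) assms(2) by blast
  then show False using assms(4) by contradiction
qed

lemma pm_rank_attained:
  fixes A S :: "'a :: cpoly_module set"
  assumes "finite A" "S \<subseteq> pm.span A"
  shows "bdd_above (card ` {B. finite B \<and> B \<subseteq> S \<and> pm.independent B})"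
    and "\<exists>B. finite B \<and> B \<subseteq> S \<and> pm.independent B \<and> card B = pm_rank S"
proof -
  let ?X = "card ` {B. finite B \<and> B \<subseteq> S \<and> pm.independent B}"
  show bdd: "bdd_above ?X"
  proof (rule bdd_aboveI)
    fix n assume "n \<in> ?X"
    then obtain B where B: "finite B" "B \<subseteq> S" "pm.independent B" "n = card B" by auto
    then show "n \<le> card A" using pm_independent_card_le[of A B] assms by auto
  qed
  have "{} \<in> {B. finite B \<and> B \<subseteq> S \<and> pm.independent B}" by (simp add: pm.independent_empty)
  then have ne: "?X \<noteq> {}" by blast
  have "Sup ?X \<in> ?X"
    using bdd ne by (simp only: Sup_nat_def bdd_above_nat if_False) (rule Max_in)
  then show "\<exists>B. finite B \<and> B \<subseteq> S \<and> pm.independent B \<and> card B = pm_rank S"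
    unfolding pm_rank_def by auto
qed

lemma pm_rank_mono:
  fixes A S T :: "'a :: cpoly_module set"
  assumes "finite A" "T \<subseteq> pm.span A" "S \<subseteq> T"
  shows "pm_rank S \<le> pm_rank T"
  unfolding pm_rank_def
proof (rule cSup_subset_mono)
  have "{} \<in> {B. finite B \<and> B \<subseteq> S \<and> pm.independent B}" by (simp add: pm.independent_empty)
  then show "card ` {B. finite B \<and> B \<subseteq> S \<and> pm.independent B} \<noteq> {}" by blast
qed (use pm_rank_attained(1)[OF assms(1,2)] assms(3) in auto)

lemma conf_word_pos: "conf_word F n x \<Longrightarrow> n \<ge> 1"
  by (induction rule: conf_word.induct) auto

lemma finite_conf_word: "finite F \<Longrightarrow> finite {x. conf_word F n x}"
proof (induction n rule: less_induct)
  case (less n)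
  have fin: "finite (range (\<lambda>k. x \<odot>\<^bsub>k\<^esub> y))" for x y :: 'a
  proof -
    have "range (\<lambda>k. x \<odot>\<^bsub>k\<^esub> y) \<subseteq> insert 0 ((\<lambda>k. x \<odot>\<^bsub>k\<^esub> y) ` {k. x \<odot>\<^bsub>k\<^esub> y \<noteq> 0})" by auto
    then show ?thesis using finite_cprod_support[of x y] by (meson finite_imageI finite_insert finite_subset)
  qed
  have "{x. conf_word F n x} \<subseteq> F \<union>
    (\<Union>m\<in>{1..<n}. \<Union>x\<in>{x. conf_word F m x}. \<Union>y\<in>{y. conf_word F (n - m) y}. range (\<lambda>k. x \<odot>\<^bsub>k\<^esub> y))"
  proof
    fix z assume "z \<in> {x. conf_word F n x}"
    then have "conf_word F n z" by simp
    then show "z \<in> F \<union>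
      (\<Union>m\<in>{1..<n}. \<Union>x\<in>{x. conf_word F m x}. \<Union>y\<in>{y. conf_word F (n - m) y}. range (\<lambda>k. x \<odot>\<^bsub>k\<^esub> y))"
    proof cases
      case (prod m x q y k)
      then have "m \<in> {1..<n}" "conf_word F (n - m) y" using conf_word_pos[of F m x] conf_word_pos[of F q y] by auto
      then show ?thesis using prod by blast
    qed auto
  qed
  moreover have "finite (F \<union>
    (\<Union>m\<in>{1..<n}. \<Union>x\<in>{x. conf_word F m x}. \<Union>y\<in>{y. conf_word F (n - m) y}. range (\<lambda>k. x \<odot>\<^bsub>k\<^esub> y)))"
    using less by (intro finite_UnI finite_UN_I fin) auto
  ultimately show ?case by (rule finite_subset)
qed

lemma finite_conf_filt_generators: "finite F \<Longrightarrow> finite {x. \<exists>n\<le>r. conf_word F n x}"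
proof -
  assume "finite F"
  have "{x. \<exists>n\<le>r. conf_word F n x} = (\<Union>n\<le>r. {x. conf_word F n x})" by auto
  then show ?thesis using finite_conf_word[OF \<open>finite F\<close>] by simp
qed

lemma pm_cscale_in_span: "x \<in> pm.span D \<Longrightarrow> c \<bullet>\<^sub>c x \<in> pm.span D"
  unfolding cscale_def by (rule pm.span_scale)

lemma pm_del_in_span: "x \<in> pm.span D \<Longrightarrow> \<partial> x \<in> pm.span D"
  unfolding del_def by (rule pm.span_scale)

lemma pscale_pCons: "pCons c p \<bullet>\<^sub>p x = c \<bullet>\<^sub>c x + \<partial> (p \<bullet>\<^sub>p (x :: 'a :: cpoly_module))"
proof -
  have "pCons c p = [:c:] + [:0, 1:] * p" by simp
  then show ?thesis
    unfolding cscale_def del_def by (simp only: pscale_left_distrib pscale_pscale)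
qed

lemma cprod_in_span:
  fixes A B D :: "'a :: conformal_algebra set"
  assumes "\<And>x y n. x \<in> A \<Longrightarrow> y \<in> B \<Longrightarrow> x \<odot>\<^bsub>n\<^esub> y \<in> pm.span D" "x \<in> pm.span A" "y \<in> pm.span B"
  shows "x \<odot>\<^bsub>n\<^esub> y \<in> pm.span D"
proof -
  have left: "(p \<bullet>\<^sub>p x) \<odot>\<^bsub>n\<^esub> y \<in> pm.span D" if "\<And>n. x \<odot>\<^bsub>n\<^esub> y \<in> pm.span D" for p n and x y :: 'a
    by (induction p arbitrary: n)
      (auto simp: pscale_pCons cprod_add_left cprod_scale_left cprod_del_left
        intro!: pm.span_add pm.span_diff pm_cscale_in_span that pm.span_zero)
  have right: "x \<odot>\<^bsub>n\<^esub> (p \<bullet>\<^sub>p y) \<in> pm.span D" if "\<And>n. x \<odot>\<^bsub>n\<^esub> y \<in> pm.span D" for p n and x y :: 'a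
    by (induction p arbitrary: n)
      (auto simp: pscale_pCons cprod_add_right cprod_scale_right cprod_del_right
        intro!: pm.span_add pm_cscale_in_span pm_del_in_span that pm.span_zero)
  have *: "x \<odot>\<^bsub>n\<^esub> y \<in> pm.span D" if "x \<in> A" for x n
    using assms(3)
  proof (induction y arbitrary: n rule: pm.span_induct_alt)
    case (step c b y)
    have "x \<odot>\<^bsub>n\<^esub> (c \<bullet>\<^sub>p b) \<in> pm.span D" by (rule right) (rule assms(1)[OF that step(1)])
    then show ?case unfolding cprod_add_right using step(2) by (rule pm.span_add)
  qed (simp add: pm.span_zero)
  show ?thesis using assms(2)
  proof (induction x arbitrary: n rule: pm.span_induct_alt)
    case (step c a x)
    have "(c \<bullet>\<^sub>p a) \<odot>\<^bsub>n\<^esub> y \<in> pm.span D" by (rule left) (rule *[OF step(1)])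
    then show ?case unfolding cprod_add_left using step(2) by (rule pm.span_add)
  qed (simp add: pm.span_zero)
qed

lemma conf_filt_mono: "r \<le> s \<Longrightarrow> conf_filt F r \<subseteq> conf_filt F s"
  unfolding conf_filt_def by (intro pm.span_mono) (use order_trans in blast)

lemma conf_filt_cprod:
  assumes "x \<in> conf_filt F r" "y \<in> conf_filt F s"
  shows "x \<odot>\<^bsub>n\<^esub> y \<in> conf_filt F (r + s)"
  unfolding conf_filt_def
proof (rule cprod_in_span)
  show "x \<in> pm.span {x. \<exists>n\<le>r. conf_word F n x}" "y \<in> pm.span {x. \<exists>n\<le>s. conf_word F n x}"
    using assms by (auto simp: conf_filt_def)
  fix x y n assume "x \<in> {x. \<exists>n\<le>r. conf_word F n x}" "y \<in> {x. \<exists>n\<le>s. conf_word F n x}"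
  then obtain i j where "i \<le> r" "j \<le> s" "conf_word F i x" "conf_word F j y" by auto
  then show "x \<odot>\<^bsub>n\<^esub> y \<in> pm.span {x. \<exists>n\<le>r + s. conf_word F n x}"
    by (intro pm.span_base) (auto intro!: exI[of _ "i + j"] conf_word.prod)
qed

lemma conf_generated_subset: "conf_generated F \<subseteq> (\<Union>r. conf_filt F r)"
proof -
  let ?U = "\<Union>r. conf_filt F r"
  have "conf_subalgebra ?U"
    unfolding conf_subalgebra_def
  proof (intro conjI ballI allI)
    show "pm.subspace ?U"
    proof (rule pm.subspaceI)
      show "0 \<in> ?U" by (auto simp: conf_filt_def pm.span_zero)
      fix x y assume "x \<in> ?U" "y \<in> ?U"
      then obtain r s where "x \<in> conf_filt F r" "y \<in> conf_filt F s" by auto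
      then have "x \<in> conf_filt F (max r s)" "y \<in> conf_filt F (max r s)"
        using conf_filt_mono[of r "max r s" F] conf_filt_mono[of s "max r s" F] by auto
      then show "x + y \<in> ?U" unfolding conf_filt_def by (blast intro: pm.span_add)
    next
      fix c x assume "x \<in> ?U"
      then show "c \<bullet>\<^sub>p x \<in> ?U" unfolding conf_filt_def by (blast intro: pm.span_scale)
    qed
    fix x y n assume "x \<in> ?U" "y \<in> ?U"
    then obtain r s where "x \<in> conf_filt F r" "y \<in> conf_filt F s" by auto
    then have "x \<odot>\<^bsub>n\<^esub> y \<in> conf_filt F (r + s)" by (rule conf_filt_cprod)
    then show "x \<odot>\<^bsub>n\<^esub> y \<in> ?U" by blast
  qed
  moreover have "F \<subseteq> ?U"
  proof
    fix x assume "x \<in> F"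
    then have "conf_word F 1 x" by (rule conf_word.gen)
    then have "x \<in> conf_filt F 1" unfolding conf_filt_def by (intro pm.span_base) auto
    then show "x \<in> ?U" by blast
  qed
  ultimately show ?thesis unfolding conf_generated_def by (intro hull_minimal)
qed

lemma conf_growth_le:
  assumes F: "finite F" and G: "finite G" "G \<subseteq> conf_generated F"
  shows "conf_growth G \<le> conf_growth F"
proof -
  have "\<forall>b\<in>G. \<exists>r. b \<in> conf_filt F r" using G(2) conf_generated_subset[of F] by blast
  then obtain r where r: "\<And>b. b \<in> G \<Longrightarrow> b \<in> conf_filt F (r b)" by metis
  define s where "s = Suc (\<Sum>b\<in>G. r b)"
  have Gs: "b \<in> conf_filt F s" if "b \<in> G" for b
  proof -
    have "r b \<le> s" using member_le_sum[of b G r] G(1) that by (simp add: s_def)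
    then show ?thesis using r[OF that] conf_filt_mono by blast
  qed
  have word: "x \<in> conf_filt F (n * s)" if "conf_word G n x" for n x
    using that
  proof induction
    case (gen x)
    then show ?case using Gs by simp
  next
    case (prod m x n y k)
    then show ?case using conf_filt_cprod[of x F "m * s" y "n * s" k] by (simp add: ring_distribs)
  qed
  have "conf_filt G q \<subseteq> conf_filt F (q * s)" for q
  proof -
    have "x \<in> conf_filt F (q * s)" if "n \<le> q" "conf_word G n x" for n x
      using word[OF that(2)] conf_filt_mono[of "n * s" "q * s" F] that(1) by (auto simp: mult_le_mono1)
    then show ?thesis
      unfolding conf_filt_def[of G] by (intro pm.span_minimal) (auto simp: conf_filt_def)
  qed
  then have "pm_rank (conf_filt G q) \<le> pm_rank (conf_filt F (q * s))" for q
    by (intro pm_rank_mono[OF finite_conf_filt_generators[OF F]]) (auto simp: conf_filt_def)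
  then show ?thesis unfolding conf_growth_def by (intro limsup_ln_growth_le[of s]) (auto simp: s_def)
qed

theorem conf_GKdim_generated:
  assumes "finite F"
  shows "conf_GKdim (conf_generated F) = conf_growth F"
  unfolding conf_GKdim_def
proof (rule antisym)
  show "(SUP G \<in> {G. finite G \<and> G \<subseteq> conf_generated F}. conf_growth G) \<le> conf_growth F"
    by (intro SUP_least) (auto intro: conf_growth_le assms)
  show "conf_growth F \<le> (SUP G \<in> {G. finite G \<and> G \<subseteq> conf_generated F}. conf_growth G)"
    using assms by (intro SUP_upper) (auto simp: conf_generated_def hull_inc)
qed

theorem conf_GKdim_eq_SUP:
  "conf_GKdim S = (SUP F \<in> {F. finite F \<and> F \<subseteq> S}. conf_GKdim (conf_generated F))"
  unfolding conf_GKdim_def[of S] by (intro SUP_cong refl) (simp add: conf_GKdim_generated)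

end

theory Submission
  imports Defs
begin

text \<open>
  Write \<open>a(n)\<close> for the class of \<open>a t\<^sup>n\<close> in the coefficient algebra. A finite-dimensional subspace \<open>V\<close>
  lies in the span of the modes \<open>f(n)\<close> with \<open>f\<close> in a finite set \<open>F\<close> and \<open>\<bar>n\<bar> \<le> K\<close>. Multiplying modes,
  \<open>w(l) f(m)\<close> is a combination of modes \<open>(w \<circ>\<^sub>j f)(l + m - j)\<close>, so \<open>V\<^sup>1 + \<dots> + V\<^sup>r\<close> is spanned by
  modes of left-normed words of length at most \<open>r\<close> in \<open>F\<close>. Two things have to be controlled: the
  range of the indices, which should grow linearly in \<open>r\<close> and accounts for the summand \<open>1\<close>, and
  the complex dimension of the span of the words, which should be \<open>O(rk C\<^sub>r)\<close>.

  The indices are controlled by locality. Associativity implies that \<open>(a \<circ>\<^sub>n b) \<circ>\<^sub>m c\<close> vanishes as soon as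
  \<open>b \<circ>\<^sub>j c\<close> vanishes for all \<open>j \<ge> m\<close> (lemma \<open>cprod_cprod_eq_0\<close>). Hence a single \<open>N\<close> that works for all
  pairs in \<open>F\<close> also bounds the locality of every left-normed word against every \<open>f \<in> F\<close>, and each
  multiplication enlarges the index range by at most \<open>K + N\<close>.

  The dimension needs more care: words of \<open>C\<^sub>r\<close> may be expressible through a basis over
  \<open>\<complex>[\<partial>]\<close> only with coefficients of unbounded degree, and torsion is invisible to the rank. The
  last multiplication removes both problems. If \<open>v \<circ>\<^sub>j f = 0\<close> for \<open>j > d\<close>, then \<open>v \<circ>\<^sub>d f / d!\<close> is the leading
  coefficient of the polynomial \<open>\<Sum>\<^sub>j \<lambda>\<^sup>j/j! (v \<circ>\<^sub>j f)\<close>, on which \<open>p(\<partial>)\<close> acts from the left as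
  multiplication by \<open>p(-\<lambda>)\<close>. Therefore complex linear independence of leading coefficients of a
  common degree forces independence over \<open>\<complex>[\<partial>]\<close> (lemma \<open>pm_independent_lift\<close>). Peeling off the
  degrees \<open>N - 1, \<dots>, 0\<close> one at a time shows that the maps \<open>j \<mapsto> v \<circ>\<^sub>j f\<close>, for \<open>v\<close> in a
  subspace of rank \<open>k\<close> with locality \<open>N\<close>, form a space of dimension at most \<open>N k\<close>, so that all
  products \<open>v \<circ>\<^sub>j f\<close> lie in a space of dimension at most \<open>N\<^sup>2 k\<close> (lemma \<open>cprods_spanned\<close>).

  Together, \<open>dim (V\<^sup>1 + \<dots> + V\<^sup>r) \<le> c r max(1, rk C\<^sub>r)\<close> with a constant \<open>c\<close> independent of \<open>r\<close>, where
  \<open>C\<^sub>r\<close> is formed with respect to \<open>F\<close>; taking logarithms gives the theorem.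
\<close>

section \<open>Modes in the coefficient algebra\<close>

definition mode :: "'a :: conformal_algebra \<Rightarrow> int \<Rightarrow> 'a coeff"
  where "mode a n = abs_coeff (mono_t n a)"

lemma mode_add: "mode (a + b) n = mode a n + mode b n"
  unfolding mode_def by (simp add: plus_coeff.abs_eq single_add)

lemma mode_zero [simp]: "mode 0 n = 0"
  unfolding mode_def by (simp add: zero_coeff.abs_eq)

lemma mode_cscale: "mode (c \<bullet>\<^sub>c a) n = coeff_scale c (mode a n)"
  unfolding mode_def by (simp add: coeff_scale.abs_eq)

lemma abs_coeff_sum: "abs_coeff (sum f A) = (\<Sum>i\<in>A. abs_coeff (f i))"
  by (induction A rule: infinite_finite_induct)
    (simp_all add: zero_coeff.abs_eq plus_coeff.abs_eq[symmetric])

lemma mode_mult: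
  assumes "\<forall>j\<ge>M. a \<odot>\<^bsub>j\<^esub> b = 0"
  shows "mode a l * mode b m =
    (\<Sum>j<M. coeff_scale (of_int l gchoose j) (mode (a \<odot>\<^bsub>j\<^esub> b) (l + m - int j)))"
proof -
  have "mode a l * mode b m = abs_coeff (lmono l a m b)"
    unfolding mode_def by (simp add: times_coeff.abs_eq lmult_mono)
  then show ?thesis
    unfolding lmono_eq_sum[OF assms] abs_coeff_sum mode_cscale[symmetric] by (simp only: mode_def)
qed

lemma lookup_tder:
  "Poly_Mapping.lookup (tder h) l =
    \<partial> (Poly_Mapping.lookup h l) + of_int (l + 1) \<bullet>\<^sub>c Poly_Mapping.lookup h (l + 1)"
proof (induction h rule: laurent_induct)
  case (mono k a)
  show ?case
    by (auto simp: tder_mono lookup_add lookup_single when_def)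
next
  case (add f g)
  then show ?case
    by (simp add: tder_add lookup_add del_add pmv.scale_right_distrib)
qed

text \<open>
  No information about \<open>C\<close> is lost in the coefficient algebra, even when \<open>C\<close> has torsion. If
  \<open>a t\<^sup>-\<^sup>1 = (\<partial> + d/dt) h\<close>, the coefficients \<open>h\<^sub>l\<close> with \<open>l \<le> -1\<close> vanish successively,
  starting from far below, since \<open>(l + 1) h\<^bsub>l+1\<^esub> = - \<partial> h\<^sub>l\<close> for \<open>l < -1\<close>. At \<open>l = -1\<close> the factor
  \<open>l + 1\<close> is zero, and the equation reads \<open>a = \<partial> h\<^bsub>-1\<^esub> = 0\<close>.
\<close>

lemma mode_minus_one_eq_0_imp:
  assumes "mode a (-1) = 0"
  shows "a = 0"
proof -
  have "coeff_rel (mono_t (-1) a) 0"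
    using assms unfolding mode_def zero_coeff.abs_eq by (simp add: coeff.abs_eq_iff)
  then obtain h where h: "mono_t (-1) a = tder h" by (auto simp: coeff_rel_iff)
  let ?h = "Poly_Mapping.lookup h"
  have rec: "\<partial> (?h l) + of_int (l + 1) \<bullet>\<^sub>c ?h (l + 1) = (if l = -1 then a else 0)" for l
    unfolding lookup_tder[symmetric] h[symmetric] by (simp add: lookup_single when_def)
  obtain L where L: "\<And>l. l < L \<Longrightarrow> ?h l = 0"
  proof (cases "Poly_Mapping.keys h = {}")
    case True
    then show ?thesis using that[of 0] by simp
  next
    case False
    have "?h l = 0" if "l < Min (Poly_Mapping.keys h)" for l
      using that Min_le[OF finite_keys, of l h] by (meson in_keys_iff not_le)
    then show ?thesis by (rule that)
  qed
  have "l \<le> -1 \<longrightarrow> ?h l = 0" if "l \<ge> min L 0 - 1" for l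
    using that
  proof (induction l rule: int_ge_induct)
    case base
    then show ?case using L[of "min L 0 - 1"] by simp
  next
    case (step l)
    show ?case
    proof
      assume l: "l + 1 \<le> -1"
      then have "of_int (l + 1) \<bullet>\<^sub>c ?h (l + 1) = 0" using rec[of l] step by simp
      moreover have "(of_int (l + 1) :: complex) \<noteq> 0" using l by (simp only: of_int_eq_0_iff)
      ultimately show "?h (l + 1) = 0" by (simp only: pmv.scale_eq_0_iff simp_thms)
    qed
  qed
  then have "?h (-1) = 0" by simp
  then show ?thesis using rec[of "-1"] by simp
qed


section \<open>Locality of products\<close>

text \<open>
  If \<open>\<phi>\<close> lists the coefficients of a formal distribution in two variables \<open>z, w\<close>, then
  \<open>locdiff n \<phi>\<close> lists those of its product with \<open>(z - w)\<^sup>n\<close>, up to a shift of the index \<open>l\<close> by \<open>n\<close>.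
  The recursive form replaces the alternating binomial sum
  \<open>\<Sum>\<^sub>i (-1)\<^sup>i (n choose i) \<phi>(l - i, m + i)\<close>.
\<close>

primrec locdiff :: "nat \<Rightarrow> (int \<Rightarrow> int \<Rightarrow> 'b) \<Rightarrow> int \<Rightarrow> int \<Rightarrow> 'b :: ab_group_add"
  where
    "locdiff 0 \<phi> l m = \<phi> l m"
  | "locdiff (Suc n) \<phi> l m = locdiff n \<phi> l m - locdiff n \<phi> (l - 1) (m + 1)"

lemma locdiff_diff:
  "locdiff n (\<lambda>l m. \<phi> l m - \<psi> l m) l m = locdiff n \<phi> l m - locdiff n \<psi> l m"
  by (induction n arbitrary: l m) (simp_all add: algebra_simps)

lemma locdiff_shift: "locdiff n (\<lambda>l m. \<phi> (l + k) m) l m = locdiff n \<phi> (l + k) m"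
  by (induction n arbitrary: l m) (simp_all add: algebra_simps)

lemma coeff_mult_diff:
  fixes x y z :: "'a :: conformal_algebra coeff"
  shows "(x - y) * z = x * z - y * z" "z * (x - y) = z * x - z * y"
  using coeff.mult_add_left[of "x - y" y z] coeff.mult_add_right[of z "x - y" y]
  by (simp_all add: algebra_simps)

lemma locdiff_mult:
  fixes z :: "'a :: conformal_algebra coeff"
  shows "locdiff n (\<lambda>l m. \<phi> l m * z) l m = locdiff n \<phi> l m * z"
    and "locdiff n (\<lambda>l m. z * \<phi> l m) l m = z * locdiff n \<phi> l m"
  by (induction n arbitrary: l m) (simp_all add: coeff_mult_diff)

text \<open>
  In terms of distributions in three variables: if \<open>(w - x)\<^sup>m\<close> annihilates the distribution in \<open>w, x\<close>
  for every fixed coefficient in \<open>z\<close>, this is still so after multiplication by \<open>(z - w)\<^sup>n\<close>.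
\<close>

lemma locdiff_locdiff_eq_0:
  assumes "\<And>l x y. locdiff m (\<psi> l) x y = 0"
  shows "locdiff m (\<lambda>x y. locdiff n (\<lambda>l p. \<psi> l p y) l x) x y = 0"
proof (induction n arbitrary: l x y)
  case (Suc n)
  have "locdiff m (\<lambda>x y. locdiff n (\<lambda>l p. \<psi> l p y) (l - 1) (x + 1)) x y = 0"
    using locdiff_shift[of m "\<lambda>x y. locdiff n (\<lambda>l p. \<psi> l p y) (l - 1) x" 1] Suc.IH by simp
  then show ?case by (simp add: locdiff_diff Suc.IH)
qed (simp add: assms)

text \<open>
  Applying \<open>locdiff\<close> to the product formula for modes takes finite differences of the binomials, so by
  Pascal's rule \<open>(l gchoose j)\<close> becomes \<open>(l - n gchoose j - n)\<close>, and the terms with \<open>j < n\<close> disappear.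
\<close>

lemma locdiff_mode_mult:
  assumes M: "\<forall>j\<ge>M. a \<odot>\<^bsub>j\<^esub> b = 0"
  shows "locdiff n (\<lambda>l m. mode a l * mode b m) l m =
    (\<Sum>j<M. if j < n then 0 else
      coeff_scale ((of_int l - of_nat n) gchoose (j - n)) (mode (a \<odot>\<^bsub>j\<^esub> b) (l + m - int j)))"
proof (induction n arbitrary: l m)
  case 0
  show ?case by (simp add: mode_mult[OF M])
next
  case (Suc n)
  have pascal: "(of_int l - of_nat n gchoose (j - n)) - (of_int (l - 1) - of_nat n gchoose (j - n)) =
    (of_int l - of_nat (Suc n) gchoose (j - Suc n) :: complex)" if j: "j > n" for j
  proof -
    obtain i where i: "j - n = Suc i" "j - Suc n = i" using j by (metis Suc_diff_Suc)
    show ?thesis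
      unfolding i using gbinomial_Suc_Suc[of "of_int l - of_nat (Suc n) :: complex" i]
      by (simp add: algebra_simps)
  qed
  show ?case
    unfolding locdiff.simps Suc.IH sum_subtractf[symmetric]
  proof (rule sum.cong[OF refl], goal_cases)
    case (1 j)
    consider "j < n" | "j = n" | "j > n" by linarith
    then show ?case
    proof cases
      case 3
      then show ?thesis
        by (simp add: coeff.scale_left_diff_distrib add.commute add.left_commute
          del: of_nat_Suc flip: pascal[OF 3])
    qed auto
  qed
qed

text \<open>
  At \<open>l = n\<close> the remaining binomials \<open>(0 gchoose j - n)\<close> select the single term \<open>j = n\<close>. This
  recovers the conformal products from the multiplication of the coefficient algebra.
\<close>

lemma mode_cprod_eq_locdiff:
  "mode (a \<odot>\<^bsub>n\<^esub> b) m = locdiff n (\<lambda>l m. mode a l * mode b m) (int n) m"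
proof -
  obtain M where M: "\<forall>j\<ge>M. a \<odot>\<^bsub>j\<^esub> b = 0" using locality by blast
  then have M': "\<forall>j\<ge>M + Suc n. a \<odot>\<^bsub>j\<^esub> b = 0" by simp
  \<comment> \<open>The range of summation is enlarged so that it certainly contains \<open>j = n\<close>.\<close>
  have "(\<Sum>j<M + Suc n. if j < n then 0 else
      coeff_scale ((of_int (int n) - of_nat n) gchoose (j - n)) (mode (a \<odot>\<^bsub>j\<^esub> b) (int n + m - int j)))
    = (\<Sum>j<M + Suc n. if j = n then mode (a \<odot>\<^bsub>n\<^esub> b) m else 0)"
  proof (rule sum.cong[OF refl], goal_cases)
    case (1 j)
    consider "j < n" | "j = n" | i where "j = n + Suc i"
      by (metis less_imp_Suc_add linorder_neqE_nat add_Suc_right)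
    then show ?case by cases (auto simp: gbinomial_0)
  qed
  then show ?thesis unfolding locdiff_mode_mult[OF M'] by simp
qed

text \<open>
  Associativity enters here. The modes of \<open>(a \<circ>\<^sub>n b) \<circ>\<^sub>m c\<close> are obtained from the triple
  products \<open>(a(l) b(p)) c(q) = a(l) (b(p) c(q))\<close> by two applications of \<open>locdiff\<close>, and the outer one
  already annihilates \<open>b(p) c(q)\<close>.
\<close>

lemma cprod_cprod_eq_0:
  fixes a b c :: "'a :: conformal_algebra"
  assumes assoc: "assoc_conformal TYPE('a)"
    and N: "\<forall>j\<ge>N. b \<odot>\<^bsub>j\<^esub> c = 0" and m: "m \<ge> N"
  shows "(a \<odot>\<^bsub>n\<^esub> b) \<odot>\<^bsub>m\<^esub> c = 0"
proof -
  have "mode ((a \<odot>\<^bsub>n\<^esub> b) \<odot>\<^bsub>m\<^esub> c) (-1) =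
    locdiff m (\<lambda>x y. locdiff n (\<lambda>l p. mode a l * (mode b p * mode c y)) (int n) x) (int m) (-1)"
    using assoc unfolding mode_cprod_eq_locdiff locdiff_mult(1)[symmetric]
    by (simp add: assoc_conformal_def)
  also have "\<dots> = 0"
  proof (rule locdiff_locdiff_eq_0)
    fix l x y
    have "locdiff m (\<lambda>p y. mode b p * mode c y) x y = 0"
      unfolding locdiff_mode_mult[OF N] using m by (intro sum.neutral) auto
    then show "locdiff m (\<lambda>p y. mode a l * (mode b p * mode c y)) x y = 0"
      by (simp add: locdiff_mult)
  qed
  finally show ?thesis by (rule mode_minus_one_eq_0_imp)
qed


section \<open>Right multiplication turns rank into dimension\<close>

text \<open>
  Since \<open>\<partial>\<close> in the left argument lowers the order of the product by one, the only term of \<open>p(\<partial>)\<close> that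
  can reach the order \<open>d + D\<close> is the one of degree \<open>D\<close>.
\<close>

lemma pscale_cprod_top:
  assumes "\<And>j. j > d \<Longrightarrow> v \<odot>\<^bsub>j\<^esub> f = 0" "degree p \<le> D"
  shows "(p \<bullet>\<^sub>p v) \<odot>\<^bsub>d + D\<^esub> f =
    ((- 1) ^ D * (fact (d + D) / fact d) * coeff p D) \<bullet>\<^sub>c (v \<odot>\<^bsub>d\<^esub> f)"
  using assms(2)
proof (induction D arbitrary: p)
  case 0
  then obtain c where "p = [:c:]" by (metis degree_eq_zeroE le_zero_eq)
  then show ?case by (simp add: cprod_scale_left flip: cscale_def)
next
  case (Suc D)
  obtain c q where p: "p = pCons c q" by (cases p)
  then have q: "degree q \<le> D" using Suc.prems by (auto split: if_splits)
  show ?case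
    unfolding p pscale_pCons cprod_add_left cprod_scale_left cprod_del_left
    using Suc.IH[OF q] assms(1)[of "d + Suc D"]
    by (simp add: algebra_simps flip: pmv.scale_minus_left)
qed

text \<open>
  In a relation over \<open>\<complex>[\<partial>]\<close> with coefficients of maximal degree \<open>D\<close>, the product of order \<open>d + D\<close>
  with \<open>f\<close> sees only the coefficients of \<open>\<partial>\<^sup>D\<close> and yields a relation over \<open>\<complex>\<close> among the
  elements \<open>v \<circ>\<^sub>d f\<close>.
\<close>

lemma pm_independent_lift:
  assumes fin: "finite B" and inj: "inj_on (\<lambda>v. v \<odot>\<^bsub>d\<^esub> f) B"
    and ind: "pmv.independent ((\<lambda>v. v \<odot>\<^bsub>d\<^esub> f) ` B)"
    and top: "\<And>v j. v \<in> B \<Longrightarrow> j > d \<Longrightarrow> v \<odot>\<^bsub>j\<^esub> f = 0"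
  shows "pm.independent B"
proof
  assume "pm.dependent B"
  then obtain u where u: "\<exists>v\<in>B. u v \<noteq> 0" "(\<Sum>v\<in>B. u v \<bullet>\<^sub>p v) = 0"
    using pm.dependent_finite[OF fin] by auto
  \<comment> \<open>Zero coefficients are excluded, so that some coefficient really has a nonzero term of degree \<open>D\<close>.\<close>
  define D where "D = Max ((\<lambda>v. degree (u v)) ` {v \<in> B. u v \<noteq> 0})"
  have "D \<in> (\<lambda>v. degree (u v)) ` {v \<in> B. u v \<noteq> 0}"
    unfolding D_def using fin u(1) by (intro Max_in) auto
  then obtain w where w: "w \<in> B" "u w \<noteq> 0" "degree (u w) = D" by auto
  have deg: "degree (u v) \<le> D" if "v \<in> B" for v
    by (cases "u v = 0") (use that fin in \<open>auto simp: D_def intro!: Max_ge\<close>)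
  define g where "g v = (- 1) ^ D * (fact (d + D) / fact d) * coeff (u v) D" for v
  have sum_left: "(\<Sum>v\<in>A. x v) \<odot>\<^bsub>n\<^esub> f = (\<Sum>v\<in>A. x v \<odot>\<^bsub>n\<^esub> f)" for A n and x :: "'a \<Rightarrow> 'a"
    by (induction A rule: infinite_finite_induct) (simp_all add: cprod_add_left)
  have "0 = (\<Sum>v\<in>B. u v \<bullet>\<^sub>p v) \<odot>\<^bsub>d + D\<^esub> f" using u(2) by simp
  also have "\<dots> = (\<Sum>v\<in>B. g v \<bullet>\<^sub>c (v \<odot>\<^bsub>d\<^esub> f))"
    unfolding sum_left g_def
    by (intro sum.cong[OF refl] pscale_cprod_top) (use top deg in auto)
  also have "\<dots> = (\<Sum>x\<in>(\<lambda>v. v \<odot>\<^bsub>d\<^esub> f) ` B. g (the_inv_into B (\<lambda>v. v \<odot>\<^bsub>d\<^esub> f) x) \<bullet>\<^sub>c x)"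
    by (simp add: sum.reindex[OF inj] the_inv_into_f_f[OF inj])
  finally have "g (the_inv_into B (\<lambda>v. v \<odot>\<^bsub>d\<^esub> f) (w \<odot>\<^bsub>d\<^esub> f)) = 0"
    using ind w(1) fin
    by (intro pmv.independentD[OF ind, of "(\<lambda>v. v \<odot>\<^bsub>d\<^esub> f) ` B"]) auto
  then have "coeff (u w) D = 0"
    using the_inv_into_f_f[OF inj w(1)] by (simp add: g_def)
  then show False using w by auto
qed

text \<open>
  Among the elements of \<open>S\<close> of locality at most \<open>d + 1\<close>, the values \<open>v \<circ>\<^sub>d f\<close> span at most \<open>k\<close>
  dimensions, by the preceding lemma. Subtracting suitable representatives of a basis of these
  values leaves elements of locality at most \<open>d\<close>, so each of the \<open>d\<close> steps of the induction adds at
  most \<open>k\<close> elements to \<open>E\<close>.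
\<close>

lemma cprod_maps_spanned:
  fixes S :: "'a :: conformal_algebra set"
  assumes S: "pmv.subspace S"
    and rank: "\<And>B. finite B \<Longrightarrow> B \<subseteq> S \<Longrightarrow> pm.independent B \<Longrightarrow> card B \<le> k"
  shows "\<exists>E. finite E \<and> card E \<le> d * k \<and>
    (\<forall>v\<in>S. (\<forall>j\<ge>d. v \<odot>\<^bsub>j\<^esub> f = 0) \<longrightarrow> (\<exists>e\<in>pmv.span E. \<forall>j. v \<odot>\<^bsub>j\<^esub> f = e \<odot>\<^bsub>j\<^esub> f))"
proof (induction d)
  case 0
  show ?case by (intro exI[of _ "{}"]) auto
next
  case (Suc d)
  then obtain E where E: "finite E" "card E \<le> d * k"
    "\<And>v. v \<in> S \<Longrightarrow> \<forall>j\<ge>d. v \<odot>\<^bsub>j\<^esub> f = 0 \<Longrightarrow> \<exists>e\<in>pmv.span E. \<forall>j. v \<odot>\<^bsub>j\<^esub> f = e \<odot>\<^bsub>j\<^esub> f"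
    by blast
  define T where "T = {v \<in> S. \<forall>j\<ge>Suc d. v \<odot>\<^bsub>j\<^esub> f = 0}"
  have T: "pmv.subspace T"
    using S unfolding T_def pmv.subspace_def by (simp add: cprod_add_left cprod_scale_left)
  let ?\<phi> = "\<lambda>v. v \<odot>\<^bsub>d\<^esub> f"
  have lift: "\<exists>L. L \<subseteq> T \<and> inj_on ?\<phi> L \<and> ?\<phi> ` L = B" if "B \<subseteq> ?\<phi> ` T" for B
    using that by (auto simp: subset_image_inj)
  have bound: "card B \<le> k" if B: "finite B" "B \<subseteq> ?\<phi> ` T" "pmv.independent B" for B
  proof -
    obtain L where L: "L \<subseteq> T" "inj_on ?\<phi> L" "?\<phi> ` L = B" using lift B(2) by blast
    have fin: "finite L" using B(1) L(2,3) finite_imageD by blast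
    have "pm.independent L"
      by (rule pm_independent_lift[OF fin L(2)]) (use L B(3) in \<open>auto simp: T_def\<close>)
    then have "card L \<le> k" using L(1) fin by (intro rank) (auto simp: T_def)
    then show ?thesis using card_image[OF L(2)] L(3) by simp
  qed
  obtain B where B: "B \<subseteq> ?\<phi> ` T" "pmv.independent B" "?\<phi> ` T \<subseteq> pmv.span B"
    by (rule pmv.basis_exists[of "?\<phi> ` T"])
  have finB: "finite B"
  proof (rule ccontr)
    assume "infinite B"
    then obtain B' where "B' \<subseteq> B" "card B' = Suc k" "finite B'"
      by (meson infinite_arbitrarily_large)
    moreover from this have "card B' \<le> k"
      using B(1) pmv.independent_mono[OF B(2)] by (intro bound) blast+
    ultimately show False by simp
  qed
  obtain L where L: "L \<subseteq> T" "inj_on ?\<phi> L" "?\<phi> ` L = B" using lift B(1) by blast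
  have finL: "finite L" using finB L(2,3) finite_imageD by blast
  have cardL: "card L \<le> k" using bound[OF finB B(1,2)] card_image[OF L(2)] L(3) by simp
  have span_img: "\<exists>y\<in>pmv.span L. x = ?\<phi> y" if "x \<in> pmv.span (?\<phi> ` L)" for x
    using that
  proof (induction x rule: pmv.span_induct_alt)
    case base
    show ?case by (intro bexI[of _ 0]) (auto intro: pmv.span_zero)
  next
    case (step c x z)
    then obtain y l where "y \<in> pmv.span L" "z = ?\<phi> y" "l \<in> L" "x = ?\<phi> l" by auto
    then show ?case
      by (intro bexI[of _ "c \<bullet>\<^sub>c l + y"])
        (auto simp: cprod_add_left cprod_scale_left
          intro: pmv.span_add[OF pmv.span_scale[OF pmv.span_base]])
  qed
  have "\<exists>e\<in>pmv.span (E \<union> L). \<forall>j. v \<odot>\<^bsub>j\<^esub> f = e \<odot>\<^bsub>j\<^esub> f" if v: "v \<in> T" for v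
  proof -
    obtain y where y: "y \<in> pmv.span L" "?\<phi> v = ?\<phi> y" using span_img B(3) v L(3) by blast
    have "y \<in> T" using y(1) L(1) T pmv.span_minimal by blast
    then have vy: "v - y \<in> T" using v T by (simp add: pmv.subspace_diff)
    have diff: "(v - y) \<odot>\<^bsub>j\<^esub> f = v \<odot>\<^bsub>j\<^esub> f - y \<odot>\<^bsub>j\<^esub> f" for j
      using cprod_add_left[of "v - y" y j f] by (simp add: algebra_simps)
    have "(v - y) \<odot>\<^bsub>j\<^esub> f = 0" if "j \<ge> d" for j
      by (cases "j = d") (use that vy y(2) diff[of d] in \<open>auto simp: T_def\<close>)
    then obtain e where e: "e \<in> pmv.span E" "\<And>j. (v - y) \<odot>\<^bsub>j\<^esub> f = e \<odot>\<^bsub>j\<^esub> f"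
      using E(3)[of "v - y"] vy by (auto simp: T_def)
    have "e + y \<in> pmv.span (E \<union> L)"
      using e(1) y(1) pmv.span_mono[of E "E \<union> L"] pmv.span_mono[of L "E \<union> L"]
      by (intro pmv.span_add) auto
    moreover have "v \<odot>\<^bsub>j\<^esub> f = (e + y) \<odot>\<^bsub>j\<^esub> f" for j
      using e(2)[of j] by (simp add: diff cprod_add_left algebra_simps)
    ultimately show ?thesis by blast
  qed
  moreover have "card (E \<union> L) \<le> Suc d * k"
    using card_Un_le[of E L] E(2) cardL by simp
  ultimately show ?case using E(1) finL by (intro exI[of _ "E \<union> L"]) (auto simp: T_def)
qed

lemma cprods_spanned:
  fixes S :: "'a :: conformal_algebra set"
  assumes S: "pmv.subspace S"
    and rank: "\<And>B. finite B \<Longrightarrow> B \<subseteq> S \<Longrightarrow> pm.independent B \<Longrightarrow> card B \<le> k"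
    and loc: "\<And>v j. v \<in> S \<Longrightarrow> j \<ge> N \<Longrightarrow> v \<odot>\<^bsub>j\<^esub> f = 0"
  shows "\<exists>G. finite G \<and> card G \<le> N * k * N \<and> (\<forall>v\<in>S. \<forall>j. v \<odot>\<^bsub>j\<^esub> f \<in> pmv.span G)"
proof -
  have "\<exists>E. finite E \<and> card E \<le> N * k \<and>
      (\<forall>v\<in>S. (\<forall>j\<ge>N. v \<odot>\<^bsub>j\<^esub> f = 0) \<longrightarrow> (\<exists>e\<in>pmv.span E. \<forall>j. v \<odot>\<^bsub>j\<^esub> f = e \<odot>\<^bsub>j\<^esub> f))"
    by (rule cprod_maps_spanned[OF S]) (rule rank)
  then obtain E where E: "finite E" "card E \<le> N * k" and
    spanned: "\<forall>v\<in>S. (\<forall>j\<ge>N. v \<odot>\<^bsub>j\<^esub> f = 0) \<longrightarrow> (\<exists>e\<in>pmv.span E. \<forall>j. v \<odot>\<^bsub>j\<^esub> f = e \<odot>\<^bsub>j\<^esub> f)"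
    by (elim exE conjE) (rule that)
  \<comment> \<open>\<open>E\<close> accounts for one factor \<open>N\<close> in the bound, the possible orders \<open>j < N\<close> for the other.\<close>
  let ?G = "(\<lambda>(e, j). e \<odot>\<^bsub>j\<^esub> f) ` (E \<times> {..<N})"
  have "card ?G \<le> card (E \<times> {..<N})" using E(1) by (intro card_image_le) simp
  also have "\<dots> \<le> N * k * N"
    unfolding card_cartesian_product card_lessThan using E(2) by (rule mult_le_mono1)
  finally have "card ?G \<le> N * k * N" .
  moreover have "v \<odot>\<^bsub>j\<^esub> f \<in> pmv.span ?G" if v: "v \<in> S" for v j
  proof (cases "j < N")
    case True
    obtain e where e: "e \<in> pmv.span E" "v \<odot>\<^bsub>j\<^esub> f = e \<odot>\<^bsub>j\<^esub> f"
      using spanned loc v by blast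
    have "e \<odot>\<^bsub>j\<^esub> f \<in> pmv.span ?G"
      using e(1)
    proof (induction e rule: pmv.span_induct_alt)
      case base
      show ?case by (simp add: pmv.span_zero)
    next
      case (step c x y)
      have "x \<odot>\<^bsub>j\<^esub> f \<in> ?G" using step(1) True by force
      then show ?case
        unfolding cprod_add_left cprod_scale_left
        by (rule pmv.span_add[OF pmv.span_scale[OF pmv.span_base] step(2)])
    qed
    then show ?thesis using e(2) by simp
  next
    case False
    then show ?thesis using loc[OF v] by (simp add: pmv.span_zero)
  qed
  ultimately show ?thesis using E(1) by (intro exI[of _ ?G]) auto
qed


section \<open>Comparison of the filtrations\<close>

definition modes :: "'a :: conformal_algebra set \<Rightarrow> nat \<Rightarrow> 'a coeff set"
  where "modes X K = {mode x n | x n. x \<in> X \<and> \<bar>n\<bar> \<le> int K}"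

lemma modes_mono: "X \<subseteq> Y \<Longrightarrow> K \<le> L \<Longrightarrow> modes X K \<subseteq> modes Y L"
  unfolding modes_def by fastforce

lemma modes_image: "modes X K = (\<lambda>(x, n). mode x n) ` (X \<times> {- int K..int K})"
  unfolding modes_def by (auto simp: abs_le_iff image_iff) (metis minus_le_iff)+

lemma finite_modes: "finite X \<Longrightarrow> finite (modes X K)"
  and card_modes: "finite X \<Longrightarrow> card (modes X K) \<le> card X * (2 * K + 1)"
proof -
  assume X: "finite X"
  then show "finite (modes X K)" unfolding modes_image by simp
  have "card (modes X K) \<le> card (X \<times> {- int K..int K})"
    unfolding modes_image using X by (intro card_image_le) simp
  then show "card (modes X K) \<le> card X * (2 * K + 1)" 
    by (simp add: card_cartesian_product nat_add_distrib nat_mult_distrib)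
qed

lemma mode_in_span_modes:
  assumes "x \<in> pmv.span X" "\<bar>n\<bar> \<le> int K"
  shows "mode x n \<in> coeff.span (modes X K)"
  using assms(1)
  by (induction x rule: pmv.span_induct_alt)
    (use assms(2) in \<open>auto simp: mode_add mode_cscale modes_def
      intro!: coeff.span_zero coeff.span_add[OF coeff.span_scale[OF coeff.span_base]]\<close>)

lemma fin_dim_subset_span_modes:
  assumes "coeff.fin_dim_subspace (V :: 'a :: conformal_algebra coeff set)"
  obtains F K where "finite F" "V \<subseteq> coeff.span (modes F K)"
proof -
  have one: "\<exists>F K. finite F \<and> x \<in> coeff.span (modes F K)" for x :: "'a coeff"
  proof (induction x rule: coeff.abs_induct, goal_cases)
    case (1 h)
    show ?case
    proof (induction h rule: laurent_induct)
      case (mono l a)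
      have "abs_coeff (mono_t l a) \<in> modes {a} (nat \<bar>l\<bar>)" by (auto simp: modes_def mode_def)
      then show ?case by (blast intro: coeff.span_base)
    next
      case (add f g)
      then obtain F K G L where "finite F" "abs_coeff f \<in> coeff.span (modes F K)"
        "finite G" "abs_coeff g \<in> coeff.span (modes G L)" by blast
      moreover have "coeff.span (modes F K) \<subseteq> coeff.span (modes (F \<union> G) (max K L))"
        "coeff.span (modes G L) \<subseteq> coeff.span (modes (F \<union> G) (max K L))"
        by (intro coeff.span_mono modes_mono; simp)+
      ultimately show ?case
        unfolding plus_coeff.abs_eq[symmetric]
        by (intro exI[of _ "F \<union> G"] exI[of _ "max K L"]) (auto intro!: coeff.span_add)
    qed
  qed
  obtain B where B: "finite B" "V = coeff.span B" using assms by (auto simp: coeff.fin_dim_subspace_def)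
  obtain F K where FK: "\<And>x. finite (F x)" "\<And>x :: 'a coeff. x \<in> coeff.span (modes (F x) (K x))"
    using one by metis
  let ?F = "\<Union>x\<in>B. F x" and ?K = "\<Sum>x\<in>B. K x"
  have "x \<in> coeff.span (modes ?F ?K)" if "x \<in> B" for x
    using FK(2)[of x] coeff.span_mono[OF modes_mono, of "F x" ?F "K x" ?K]
      member_le_sum[of x B K] that B(1) by auto
  then have "V \<subseteq> coeff.span (modes ?F ?K)" unfolding B(2) by (intro coeff.span_minimal) auto
  then show ?thesis using that[of ?F ?K] B(1) FK(1) by auto
qed

lemma mult_in_span_modes_cprods:
  assumes w: "w \<in> modes X K" and f: "y \<in> modes F L"
    and loc: "\<And>x f j. x \<in> X \<Longrightarrow> f \<in> F \<Longrightarrow> j \<ge> N \<Longrightarrow> x \<odot>\<^bsub>j\<^esub> f = 0"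
  shows "w * y \<in> coeff.span (modes {x \<odot>\<^bsub>j\<^esub> f | x j f. x \<in> X \<and> f \<in> F} (K + L + N))"
proof -
  obtain x n f m where *: "w = mode x n" "x \<in> X" "\<bar>n\<bar> \<le> int K" "y = mode f m" "f \<in> F" "\<bar>m\<bar> \<le> int L"
    using w f by (auto simp: modes_def)
  have "\<forall>j\<ge>N. x \<odot>\<^bsub>j\<^esub> f = 0" using loc * by blast
  from mode_mult[OF this] show ?thesis
    unfolding *(1,4)
  proof (simp only:, intro coeff.span_sum coeff.span_scale coeff.span_base, goal_cases)
    case (1 j)
    then have "\<bar>n + m - int j\<bar> \<le> int (K + L + N)" using *(3,6) by auto
    then show ?case unfolding modes_def using *(2,5) by blast
  qed
qed

text \<open>
  The left-normed words enter only through the two properties that matter for them: \<open>W r\<close> is the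
  space of all elements of \<open>C\<^sub>r\<close> that have locality at most \<open>N\<close> against all of \<open>F\<close>. It contains \<open>F\<close>
  for \<open>r \<ge> 1\<close>, and multiplying it from the right by \<open>F\<close> leads into \<open>W (r + 1)\<close>. The powers of
  \<open>V\<close> beyond the first lie in the span of modes of the products collected in \<open>P r\<close>, to which the dimension
  bound in terms of the rank of \<open>W r\<close> applies.
\<close>

lemma dim_filt_le_rank:
  fixes F :: "'a :: conformal_algebra set"
  assumes assoc: "assoc_conformal TYPE('a)" and F: "finite F"
    and V: "V \<subseteq> coeff.span (modes F K)"
  shows "\<exists>c. \<forall>r\<ge>1. coeff.dim (coeff.filt V r) \<le> c * r * max 1 (pm_rank (conf_filt F r))"
proof -
  have "\<forall>p. \<exists>N. \<forall>j\<ge>N. fst p \<odot>\<^bsub>j\<^esub> snd p = (0 :: 'a)" using locality by blast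
  then obtain n :: "'a \<times> 'a \<Rightarrow> nat" where n: "\<And>p j. j \<ge> n p \<Longrightarrow> fst p \<odot>\<^bsub>j\<^esub> snd p = 0" by metis
  \<comment> \<open>The sum serves as an upper bound that is meaningful also for empty \<open>F\<close>.\<close>
  define N where "N = sum n (F \<times> F)"
  have loc: "f \<odot>\<^bsub>j\<^esub> g = 0" if "f \<in> F" "g \<in> F" "j \<ge> N" for f g j
    using n[of "(f, g)" j] member_le_sum[of "(f, g)" "F \<times> F" n] that F by (simp add: N_def)
  define U where "U = {v. \<forall>f\<in>F. \<forall>j\<ge>N. v \<odot>\<^bsub>j\<^esub> f = 0}"
  have U_prod: "a \<odot>\<^bsub>i\<^esub> f \<in> U" if "f \<in> F" for a f i
    unfolding U_def using cprod_cprod_eq_0[OF assoc, of N f] loc that by blast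
  define W where "W r = conf_filt F r \<inter> U" for r
  have W_sub: "pmv.subspace (W r)" for r
    unfolding W_def U_def conf_filt_def pmv.subspace_def
    by (auto simp: cprod_add_left cprod_scale_left pm_cscale_in_span intro: pm.span_zero pm.span_add)
  have W_mono: "W r \<subseteq> W s" if "r \<le> s" for r s
    using conf_filt_mono[OF that, of F] by (auto simp: W_def)
  have F_filt: "F \<subseteq> conf_filt F 1"
    unfolding conf_filt_def using conf_word.gen by (fastforce intro: pm.span_base)
  then have FW: "F \<subseteq> W 1" using loc by (auto simp: W_def U_def)
  have W_prod: "w \<odot>\<^bsub>j\<^esub> f \<in> W (Suc r)" if "w \<in> W r" "f \<in> F" for w j f r
    using conf_filt_cprod[of w F r f 1 j] F_filt U_prod that by (auto simp: W_def)
  have W_loc: "w \<odot>\<^bsub>j\<^esub> f = 0" if "w \<in> W r" "f \<in> F" "j \<ge> N" for w f j r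
    using that by (auto simp: W_def U_def)
  define P where "P r = {w \<odot>\<^bsub>j\<^esub> f | w j f. w \<in> W r \<and> f \<in> F}" for r
  have P_mono: "P r \<subseteq> P s" if "r \<le> s" for r s
    using W_mono[OF that] unfolding P_def by blast
  define c where "c = K + N"
  have mult: "x * y \<in> coeff.span (modes (P r) (L + c))"
    if "x \<in> coeff.span (modes X L)" "y \<in> V" "X \<subseteq> W r" for x y r L X
  proof (rule coeff.span_mult[OF _ that(1)])
    show "y \<in> coeff.span (modes F K)" using that(2) V by blast
    fix x y assume xy: "x \<in> modes X L" "y \<in> modes F K"
    have "x * y \<in> coeff.span (modes {x \<odot>\<^bsub>j\<^esub> f | x j f. x \<in> X \<and> f \<in> F} (L + K + N))"
      by (rule mult_in_span_modes_cprods[OF xy]) (use W_loc that(3) in blast)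
    also have "\<dots> \<subseteq> coeff.span (modes (P r) (L + c))"
      using that(3) by (intro coeff.span_mono modes_mono) (auto simp: P_def c_def)
    finally show "x * y \<in> coeff.span (modes (P r) (L + c))" .
  qed
  have pow: "coeff.vpow V (Suc k) \<subseteq> coeff.span (modes (P (Suc k)) (Suc (Suc k) * c))" for k
  proof (induction k)
    case 0
    have "x * y \<in> coeff.span (modes (P 1) (c + c))" if "x \<in> V" "y \<in> V" for x y
    proof -
      have "x \<in> coeff.span (modes F c)"
        using V that(1) coeff.span_mono[OF modes_mono, of F F K c] by (auto simp: c_def)
      then show ?thesis using that(2) FW by (rule mult)
    qed
    then have "coeff.span {x * y | x y. x \<in> V \<and> y \<in> V} \<subseteq> coeff.span (modes (P 1) (c + c))"
      by (intro coeff.span_minimal) auto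
    then show ?case by simp
  next
    case (Suc k)
    have "P (Suc k) \<subseteq> W (Suc (Suc k))" using W_prod by (auto simp: P_def)
    then have "x * y \<in> coeff.span (modes (P (Suc (Suc k))) (Suc (Suc k) * c + c))"
      if "x \<in> coeff.vpow V (Suc k)" "y \<in> V" for x y
      using Suc that by (intro mult) auto
    then have "coeff.span {x * y | x y. x \<in> coeff.vpow V (Suc k) \<and> y \<in> V} \<subseteq>
        coeff.span (modes (P (Suc (Suc k))) (Suc (Suc k) * c + c))"
      by (intro coeff.span_minimal) auto
    then show ?case unfolding coeff.vpow.simps(2)[of V "Suc k"] by (simp add: algebra_simps)
  qed
  have main: "coeff.dim (coeff.filt V r) \<le>
      (card F + card F * (N * N)) * (2 * c + 1) * r * max 1 (pm_rank (conf_filt F r))"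
    if r: "r \<ge> 1" for r
  proof -
    let ?k = "pm_rank (conf_filt F r)"
    have rank: "card B \<le> ?k" if "finite B" "B \<subseteq> W r" "pm.independent B" for B
      unfolding pm_rank_def
      using that pm_rank_attained(1)[OF finite_conf_filt_generators[OF F], of "conf_filt F r" r]
      by (intro cSup_upper) (auto simp: conf_filt_def W_def)
    have "\<exists>G. finite G \<and> card G \<le> N * ?k * N \<and> (\<forall>v\<in>W r. \<forall>j. v \<odot>\<^bsub>j\<^esub> f \<in> pmv.span G)"
      if "f \<in> F" for f
      by (rule cprods_spanned[OF W_sub rank W_loc]) (use that in auto)
    then obtain G where G: "\<And>f. f \<in> F \<Longrightarrow> finite (G f)" "\<And>f. f \<in> F \<Longrightarrow> card (G f) \<le> N * ?k * N"
      "\<And>f v j. f \<in> F \<Longrightarrow> v \<in> W r \<Longrightarrow> v \<odot>\<^bsub>j\<^esub> f \<in> pmv.span (G f)" by metis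
    define X where "X = F \<union> (\<Union>f\<in>F. G f)"
    have finX: "finite X" using F G(1) by (simp add: X_def)
    have "card (\<Union>f\<in>F. G f) \<le> (\<Sum>f\<in>F. card (G f))" by (rule card_UN_le[OF F])
    also have "\<dots> \<le> card F * (N * ?k * N)"
      using G(2) by (intro sum_bounded_above[where 'a = nat, simplified]) auto
    finally have cardX: "card X \<le> card F + card F * (N * ?k * N)"
      using card_Un_le[of F "\<Union>f\<in>F. G f"] by (simp add: X_def)
    have PX: "P r \<subseteq> pmv.span X"
      unfolding P_def X_def using G(3) pmv.span_mono[of "G _" "F \<union> (\<Union>f\<in>F. G f)"] by blast
    have "coeff.vpow V k \<subseteq> coeff.span (modes X (r * c))" if k: "k < r" for k
    proof (cases k)
      case 0
      have "K \<le> r * c" using r by (metis c_def le_add1 mult_le_mono nat_mult_1 order_trans)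
      then have "coeff.span (modes F K) \<subseteq> coeff.span (modes X (r * c))"
        by (intro coeff.span_mono modes_mono) (auto simp: X_def)
      then show ?thesis using 0 V by simp
    next
      case (Suc i)
      have "modes (P (Suc i)) (Suc (Suc i) * c) \<subseteq> modes (P r) (r * c)"
        using Suc k by (intro modes_mono P_mono mult_le_mono1) auto
      also have "\<dots> \<subseteq> coeff.span (modes X (r * c))"
        using PX mode_in_span_modes[of _ X _ "r * c"] by (auto simp: modes_def[of "P r"])
      finally have "coeff.span (modes (P (Suc i)) (Suc (Suc i) * c)) \<subseteq> coeff.span (modes X (r * c))"
        by (intro coeff.span_minimal) auto
      then show ?thesis using pow[of i] Suc by blast
    qed
    then have "coeff.filt V r \<subseteq> coeff.span (modes X (r * c))"
      unfolding coeff.filt_def by (intro coeff.span_minimal) auto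
    then have "coeff.dim (coeff.filt V r) \<le> card (modes X (r * c))"
      using finite_modes[OF finX] by (rule coeff.dim_le_card)
    also have "\<dots> \<le> card X * (2 * (r * c) + 1)" by (rule card_modes[OF finX])
    also have "\<dots> \<le> (card F + card F * (N * N)) * max 1 ?k * ((2 * c + 1) * r)"
    proof (rule mult_le_mono)
      have "card F \<le> card F * max 1 ?k" by simp
      moreover have "N * ?k * N \<le> (N * N) * max 1 ?k" by (simp add: algebra_simps)
      ultimately show "card X \<le> (card F + card F * (N * N)) * max 1 ?k"
        using cardX mult_le_mono2[of "N * ?k * N" "(N * N) * max 1 ?k" "card F"]
        unfolding add_mult_distrib mult.assoc by linarith
      show "2 * (r * c) + 1 \<le> (2 * c + 1) * r" using r by (simp add: algebra_simps)
    qed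
    finally show ?thesis by (simp only: mult_ac)
  qed
  then show ?thesis by blast
qed

text \<open>
  The maximum with \<open>1\<close> makes the bound meaningful when all ranks vanish; it does not affect the
  logarithm, because \<open>ln 0 = 0 = ln 1\<close>.
\<close>

lemma limsup_ln_le_add_one:
  fixes f g :: "nat \<Rightarrow> nat"
  assumes le: "\<And>r. r \<ge> 1 \<Longrightarrow> f r \<le> c * r * max 1 (g r)"
  shows "limsup (\<lambda>r. ereal (ln (real (f r)) / ln (real r))) \<le>
    limsup (\<lambda>r. ereal (ln (real (g r)) / ln (real r))) + 1"
proof -
  have bound: "ln (real (f r)) / ln (real r) \<le>
      (ln (real (Suc c)) / ln (real r) + 1) + ln (real (g r)) / ln (real r)" if r: "r \<ge> 2" for r
  proof -
    have pos: "ln (real r) > 0" using r by simp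
    have lng: "ln (real (max 1 (g r))) = ln (real (g r))" by (cases "g r = 0") (auto simp: max_def)
    have q: "Suc c * r * max 1 (g r) > 0" using r by (simp only: nat_0_less_mult_iff) simp
    have "f r \<le> c * r * max 1 (g r)" using le r by simp
    also have "\<dots> \<le> Suc c * r * max 1 (g r)" by (intro mult_le_mono) simp_all
    finally have le': "f r \<le> Suc c * r * max 1 (g r)" .
    have "ln (real (f r)) \<le> ln (real (Suc c * r * max 1 (g r)))"
    proof (cases "f r = 0")
      case True
      then show ?thesis using q by (simp only: of_nat_0 ln_0) (intro ln_ge_zero, linarith)
    next
      case False
      then show ?thesis using le' by (intro ln_mono) (simp_all only: of_nat_0_less_iff of_nat_le_iff neq0_conv)
    qed
    also have "\<dots> = ln (real (Suc c)) + ln (real r) + ln (real (max 1 (g r)))"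
    proof -
      have "real (Suc c) > 0" "real r > 0" "real (max 1 (g r)) > 0" using r by auto
      then show ?thesis by (simp only: of_nat_mult ln_mult_pos mult_pos_pos)
    qed
    also note lng
    finally have "ln (real (f r)) / ln (real r) \<le>
        (ln (real (Suc c)) + ln (real r) + ln (real (g r))) / ln (real r)"
      using pos by (intro divide_right_mono) auto
    then show ?thesis using pos by (simp add: add_divide_distrib)
  qed
  have "(\<lambda>r. ln (real (Suc c)) / ln (real r)) \<longlonglongrightarrow> 0"
    by (rule real_tendsto_divide_at_top[OF tendsto_const
          filterlim_compose[OF ln_at_top filterlim_real_sequentially]])
  from tendsto_add[OF this tendsto_const[of 1]]
  have lim: "(\<lambda>r. ereal (ln (real (Suc c)) / ln (real r) + 1)) \<longlonglongrightarrow> 1" by (simp add: one_ereal_def)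
  have "limsup (\<lambda>r. ereal (ln (real (f r)) / ln (real r))) \<le>
      limsup (\<lambda>r. ereal (ln (real (Suc c)) / ln (real r) + 1) + ereal (ln (real (g r)) / ln (real r)))"
    by (intro Limsup_mono eventually_sequentiallyI[of 2]) (use bound in simp)
  also have "\<dots> = 1 + limsup (\<lambda>r. ereal (ln (real (g r)) / ln (real r)))"
    by (rule ereal_limsup_lim_add[OF lim]) simp
  finally show ?thesis by (simp add: add.commute)
qed

theorem theorem2p4:
  assumes "assoc_conformal TYPE('a :: conformal_algebra)"
  shows "coeff.GKdim (UNIV :: 'a coeff set) \<le> conf_GKdim (UNIV :: 'a set) + 1"
  unfolding coeff.GKdim_def
proof (rule SUP_least)
  fix V :: "'a coeff set" assume "V \<in> {V. coeff.fin_dim_subspace V \<and> V \<subseteq> UNIV}"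
  then obtain F K where F: "finite F" and V: "V \<subseteq> coeff.span (modes F K)"
    using fin_dim_subset_span_modes by blast
  obtain c where "\<And>r. r \<ge> 1 \<Longrightarrow>
      coeff.dim (coeff.filt V r) \<le> c * r * max 1 (pm_rank (conf_filt F r))"
    using dim_filt_le_rank[OF assms F V] by blast
  then have "coeff.growth V \<le> conf_growth F + 1"
    unfolding coeff.growth_def conf_growth_def by (rule limsup_ln_le_add_one)
  also have "conf_growth F \<le> conf_GKdim (UNIV :: 'a set)"
    unfolding conf_GKdim_def using F by (intro SUP_upper) simp
  finally show "coeff.growth V \<le> conf_GKdim (UNIV :: 'a set) + 1" by (simp add: add_right_mono)
qed

end
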